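(* There exist universal constants $C,c,\varepsilon_0,\delta_0>0$ with $\varepsilon_0<1$ such that for all integers $1\le s\le n$, all $0<\varepsilon\le\varepsilon_0$ and all $0<\delta\le\delta_0$, $$c\,\frac{sn}{\log(2s)}\ \le\ m^{(0)}(\mathcal S_{n,s},\varepsilon,\delta)\ \le\ C\,sn\log^2(2s).$$ Therefore $m^{(0)}(\mathcal S_{n,s},\varepsilon,\delta)=\widetilde\Theta(sn)$ in this range of parameters (where $\widetilde\Theta$ hides polylogarithmic factors, here powers of $\log(2s)$).
   Context: For $S\subseteq[n]$ let $\chi_S(x)=\prod_{i\in S}x_i$ on $\{-1,1\}^n$ ($\chi_\emptyset=1$), and $\|f\|_{L_\infty}=\max_{x\in\{-1,1\}^n}|f(x)|$. $\mathcal S_{n,s}$ is the set of $f=\sum_{S\subseteq[n]}\theta_S\chi_S$ (real coefficients) with at most $s$ nonzero coefficients $\theta_S$ and $\|f\|_{L_\infty}\le1$. Noiseless adaptive query model: at each round $t=1,\dots,m$ the learner picks $X_t\in\{-1,1\}^n$, possibly depending on $(X_1,f(X_1)),\dots,(X_{t-1},f(X_{t-1}))$ and on internal randomness, and observes the exact value $f(X_t)$. It then outputs $\widehat f:\{-1,1\}^n\to\mathbb R$. $m^{(0)}(\mathcal F,\varepsilon,\delta)$ is the infimum of the integers $m\ge0$ for which some (possibly randomized) adaptive $m$-query learner satisfies $\mathbb P_f(\|f-\widehat f\|_{L_\infty}>\varepsilon)\le\delta$ for every $f\in\mathcal F$. *)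

theory Defs
  imports "HOL-Probability.Probability"
begin

type_synonym point = "nat \<Rightarrow> real"

text \<open>Points of \<open>{-1,1}\<^sup>n\<close> are extensional functions on \<open>{1..n}\<close>, since \<open>n\<close> varies in the statement.\<close>

definition cube :: "nat \<Rightarrow> point set" where
  "cube n = {1..n} \<rightarrow>\<^sub>E {-1, 1}"

definition chi :: "nat set \<Rightarrow> point \<Rightarrow> real" where
  "chi S x = (\<Prod>i\<in>S. x i)"

definition linf :: "nat \<Rightarrow> (point \<Rightarrow> real) \<Rightarrow> real" where
  "linf n f = Max ((\<lambda>x. \<bar>f x\<bar>) ` cube n)"

definition sparse_class :: "nat \<Rightarrow> nat \<Rightarrow> (point \<Rightarrow> real) set" where
  "sparse_class n s = {f. \<exists>\<theta> :: nat set \<Rightarrow> real.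
     f = (\<lambda>x\<in>cube n. \<Sum>S\<in>Pow {1..n}. \<theta> S * chi S x) \<and>
     card {S \<in> Pow {1..n}. \<theta> S \<noteq> 0} \<le> s \<and> linf n f \<le> 1}"

type_synonym history = "(point \<times> real) list"

text \<open>The first \<open>t\<close> query-answer pairs, oldest first, when the rule \<open>q\<close> is run on \<open>f\<close>.\<close>

primrec transcript :: "(history \<Rightarrow> point) \<Rightarrow> (point \<Rightarrow> real) \<Rightarrow> nat \<Rightarrow> history" where
  "transcript q f 0 = []"
| "transcript q f (Suc t) =
     (let h = transcript q f t; x = q h in h @ [(x, f x)])"

text \<open>
  The internal randomness of a learner is a seed \<open>\<omega>\<close> drawn once from a probability space
  \<open>M\<close>; given \<open>\<omega>\<close>, \<open>qry \<omega>\<close> and \<open>est \<omega>\<close> map the observed history to the next query and to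
  the final estimate. Taking the seed in the type of reals loses no generality: for a fixed
  target only finitely many histories can occur, and fresh randomness at each of the finitely many
  rounds can be extracted from a single uniform variable. Measurability for each fixed
  history therefore also suffices to make the failure event below measurable.
  The count space forces queries to lie in the cube.
\<close>

definition learner ::
    "nat \<Rightarrow> real measure \<Rightarrow> (real \<Rightarrow> history \<Rightarrow> point) \<Rightarrow>
     (real \<Rightarrow> history \<Rightarrow> point \<Rightarrow> real) \<Rightarrow> bool" where
  "learner n M qry est \<longleftrightarrow>
     prob_space M \<and>
     (\<forall>h. (\<lambda>\<omega>. qry \<omega> h) \<in> M \<rightarrow>\<^sub>M count_space (cube n)) \<and>
     (\<forall>h. \<forall>x\<in>cube n. (\<lambda>\<omega>. est \<omega> h x) \<in> borel_measurable M)"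

definition failure_prob ::
    "nat \<Rightarrow> nat \<Rightarrow> real measure \<Rightarrow> (real \<Rightarrow> history \<Rightarrow> point) \<Rightarrow>
     (real \<Rightarrow> history \<Rightarrow> point \<Rightarrow> real) \<Rightarrow> real \<Rightarrow> (point \<Rightarrow> real) \<Rightarrow> real" where
  "failure_prob n m M qry est \<epsilon> f =
     measure M {\<omega> \<in> space M.
       linf n (\<lambda>x. f x - est \<omega> (transcript (qry \<omega>) f m) x) > \<epsilon>}"

text \<open>Extended reals, so that the infimum of the empty set is infinite.\<close>

definition query_complexity ::
    "nat \<Rightarrow> (point \<Rightarrow> real) set \<Rightarrow> real \<Rightarrow> real \<Rightarrow> ereal" where
  "query_complexity n \<F> \<epsilon> \<delta> =
     (INF m \<in> {m :: nat. \<exists>M qry est. learner n M qry est \<and>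
                 (\<forall>f\<in>\<F>. failure_prob n m M qry est \<epsilon> f \<le> \<delta>)}. ereal (real m))"

text \<open>\<open>F = \<Theta>(g)\<close> up to powers of \<open>L\<close>, uniformly over the parameter range \<open>D\<close>.\<close>

definition soft_Theta_on ::
    "'p set \<Rightarrow> ('p \<Rightarrow> real) \<Rightarrow> ('p \<Rightarrow> ereal) \<Rightarrow> ('p \<Rightarrow> real) \<Rightarrow> bool" where
  "soft_Theta_on D L F g \<longleftrightarrow>
     (\<exists>a>0. \<exists>A>0. \<exists>k l :: nat. \<forall>p\<in>D.
        ereal (a * g p / L p ^ k) \<le> F p \<and> F p \<le> ereal (A * g p * L p ^ l))"

end

theory Submission
  imports Defs
begin

text \<open>
  Upper bound: answers are exact, so it suffices to find \<open>m\<close> fixed points of the cube on which no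
  nonzero function of Fourier sparsity at most \<open>k = 2 s\<close> vanishes; then the answers determine the
  target, for every \<open>\<epsilon>\<close> and \<open>\<delta>\<close>. A random set of points works. After normalising the coefficients
  to \<open>\<Sum>\<bar>\<theta>\<^sub>S\<bar> = 1\<close>, such an \<open>f\<close> has mean square at least \<open>1/k\<close>, hence there is a dyadic level
  \<open>\<eta> = 2\<^sup>-\<^sup>i\<close> with \<open>P(\<bar>f\<bar> \<ge> \<eta>)\<close> of order at least \<open>1/(\<eta>\<^sup>2 k log k)\<close>. By Maurey's empirical
  method \<open>f\<close> is within \<open>\<eta>/2\<close>, at nearly all points of the cube and of the sample, of an average of
  about \<open>\<eta>\<^sup>-\<^sup>2 log k\<close> signed characters, and a union bound over these averages needs only
  \<open>k n log\<^sup>2 k\<close> points.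

  Lower bound: with \<open>r \<approx> s/2\<close>, the functions \<open>(1/r) \<Sum>\<^sub>i\<^sub>\<le>\<^sub>r x\<^sub>i \<chi>\<^bsub>A\<^sub>i\<^esub>\<close>, where each \<open>A\<^sub>i\<close> avoids
  \<open>{1..r}\<close>, take only \<open>r + 1\<close> values, so a deterministic learner sees at most \<open>(r + 1)\<^sup>m\<close>
  transcripts. The distance of two of them is at least the fraction of indices in which the
  tuples \<open>A\<close> differ, so each transcript serves only a small Hamming ball of tuples.
\<close>

section \<open>Characters, sampling and empirical averages\<close>

lemma finite_cube [simp]: "finite (cube n)"
  by (simp add: cube_def finite_PiE)

lemma card_cube: "card (cube n) = 2 ^ n"
  by (simp add: cube_def card_PiE numeral_2_eq_2)

lemma cube_nonempty [simp]: "cube n \<noteq> {}"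
  by (simp add: cube_def PiE_eq_empty_iff)

lemma abs_chi:
  assumes "x \<in> cube n" "S \<subseteq> {1..n}"
  shows "\<bar>chi S x\<bar> = 1"
proof -
  have "\<bar>x i\<bar> = 1" if "i \<in> S" for i
    using assms that by (force simp: cube_def PiE_iff)
  then show ?thesis by (simp add: chi_def abs_prod)
qed

lemma chi_cases:
  assumes "x \<in> cube n" "S \<subseteq> {1..n}"
  shows "chi S x = 1 \<or> chi S x = -1"
  using abs_chi[OF assms] by linarith

lemma chi_eq_prod:
  assumes "S \<subseteq> {1..n}"
  shows "chi S x = (\<Prod>i\<in>{1..n}. if i \<in> S then x i else 1)"
  using assms by (simp add: chi_def prod.If_cases Int_absorb1)

text \<open>The sum over the cube factorises over coordinates, and a coordinate lying in exactly one
  of \<open>S\<close> and \<open>T\<close> contributes the factor \<open>-1 + 1 = 0\<close>.\<close>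

lemma sum_chi_mult_chi:
  assumes "S \<subseteq> {1..n}" "T \<subseteq> {1..n}"
  shows "(\<Sum>x\<in>cube n. chi S x * chi T x) = (if S = T then 2 ^ n else 0)"
proof -
  have "(\<Sum>x\<in>cube n. chi S x * chi T x)
      = (\<Sum>x\<in>cube n. \<Prod>i\<in>{1..n}. (if i \<in> S then x i else 1) * (if i \<in> T then x i else 1))"
    using assms by (simp add: chi_eq_prod prod.distrib)
  also have "\<dots> = (\<Prod>i\<in>{1..n}. \<Sum>b\<in>{-1,1::real}. (if i \<in> S then b else 1) * (if i \<in> T then b else 1))"
    unfolding cube_def by (rule prod_sum_PiE[symmetric]) auto
  also have "\<dots> = (\<Prod>i\<in>{1..n}. if i \<in> S \<longleftrightarrow> i \<in> T then 2 else 0)"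
    by (rule prod.cong) auto
  also have "\<dots> = (if S = T then 2 ^ n else 0)"
  proof (cases "S = T")
    case False
    then obtain i where "i \<in> {1..n}" "\<not> (i \<in> S \<longleftrightarrow> i \<in> T)"
      using assms by blast
    then show ?thesis using False by (auto intro!: prod_zero)
  qed simp
  finally show ?thesis .
qed

section \<open>Random samples that hit every member of a family of dense sets\<close>

lemma exp_ln2_bound:
  fixes y :: real
  assumes "y \<ge> 0"
  shows "exp (- (3/4) * y) \<le> (1/2) powr y"
proof -
  have "ln (1/2::real) = - ln 2" by (simp add: ln_div)
  \<comment> \<open>The rational bound \<open>3/4\<close> on \<open>ln 2\<close> keeps the exponents
    of the Chernoff estimate rational.\<close>
  moreover have "ln 2 * y \<le> (3/4) * y"
    using ln2_le_25_over_36 assms by (intro mult_right_mono) auto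
  ultimately show ?thesis by (simp add: powr_def mult.commute)
qed

text \<open>Chernoff's method with the moment \<open>E 2\<^sup>-\<^sup>N\<close>, where \<open>N\<close> counts the hits of \<open>B\<close>.\<close>

lemma card_few_hits:
  fixes q :: real
  assumes fin: "finite X" and B: "B \<subseteq> X" and q: "0 \<le> q" "q * card X \<le> card B"
  shows "real (card {Q \<in> {..<m} \<rightarrow>\<^sub>E X. real (card {i. i < m \<and> Q i \<in> B}) < m * q / 2})
           \<le> card X ^ m * exp (- (m * q / 8))"
proof -
  let ?N = "\<lambda>Q. card {i. i < m \<and> Q i \<in> B}"
  let ?Bad = "{Q \<in> {..<m} \<rightarrow>\<^sub>E X. real (?N Q) < m * q / 2}"
  have finP: "finite ({..<m} \<rightarrow>\<^sub>E X)" using fin by (auto intro: finite_PiE)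
  have finB: "finite B" using B fin finite_subset by blast
  have "real (card ?Bad) * exp (- (3/4) * (m * q / 2)) = (\<Sum>Q\<in>?Bad. exp (- (3/4) * (m * q / 2)))"
    by simp
  also have "\<dots> \<le> (\<Sum>Q\<in>?Bad. (1/2) ^ ?N Q)"
  proof (rule sum_mono)
    fix Q assume Q: "Q \<in> ?Bad"
    have "exp (- (3/4) * (m * q / 2)) \<le> (1/2) powr (m * q / 2)"
      using q by (intro exp_ln2_bound) auto
    also have "\<dots> \<le> (1/2) powr real (?N Q)"
      using Q by (intro powr_mono') auto
    also have "\<dots> = (1/2) ^ ?N Q" by (simp add: powr_realpow)
    finally show "exp (- (3/4) * (m * q / 2)) \<le> (1/2) ^ ?N Q" .
  qed
  also have "\<dots> \<le> (\<Sum>Q\<in>{..<m} \<rightarrow>\<^sub>E X. (1/2) ^ ?N Q)"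
    by (rule sum_mono2) (auto simp: finP)
  \<comment> \<open>Written as a product over the draws, the moment factorises into \<open>m\<close>
    equal sums over \<open>X\<close>.\<close>
  also have "\<dots> = (\<Sum>Q\<in>{..<m} \<rightarrow>\<^sub>E X. \<Prod>i\<in>{..<m}. if Q i \<in> B then 1/2 else 1)"
    by (rule sum.cong) (auto simp: prod.If_cases Int_def)
  also have "\<dots> = (\<Prod>i\<in>{..<m}. \<Sum>x\<in>X. if x \<in> B then 1/2 else 1)"
    by (rule prod_sum_PiE[symmetric]) (auto simp: fin)
  also have "\<dots> = (card X - card B / 2) ^ m"
  proof -
    have "(\<Sum>x\<in>X. if x \<in> B then 1/2 else (1::real)) = (\<Sum>x\<in>X. 1 - (if x \<in> B then 1/2 else 0))"
      by (rule sum.cong) auto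
    also have "\<dots> = card X - card B / 2"
      using B fin by (simp add: sum_subtractf sum.If_cases Int_absorb1)
    finally show ?thesis by simp
  qed
  also have "\<dots> \<le> (card X * exp (- (q / 2))) ^ m"
  proof (rule power_mono)
    have "1 - q / 2 \<le> exp (- (q / 2))" using exp_ge_add_one_self[of "- (q / 2)"] by simp
    then have "card X * (1 - q / 2) \<le> card X * exp (- (q / 2))" by (intro mult_left_mono) auto
    then show "card X - card B / 2 \<le> card X * exp (- (q / 2))"
      using q by (simp add: algebra_simps)
    have "card B \<le> card X" using B fin card_mono by blast
    then show "0 \<le> real (card X) - card B / 2" by simp
  qed
  also have "\<dots> = card X ^ m * exp (- (m * q / 2))"
    by (simp add: power_mult_distrib exp_of_nat_mult[symmetric])
  \<comment> \<open>Moving the factor of the Markov step to the right leaves the exponent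
    \<open>3/8 - 1/2 = -1/8\<close>.\<close>
  finally have "real (card ?Bad) * exp (- (3/4) * (m * q / 2)) * exp (3 * (m * q) / 8)
      \<le> card X ^ m * exp (- (m * q / 2)) * exp (3 * (m * q) / 8)"
    by (intro mult_right_mono) auto
  then show ?thesis by (simp add: mult.assoc exp_add[symmetric] mult.commute[of q])
qed

text \<open>Union bound: the samples that are bad for some \<open>j\<close> do not fill the sample
  space. The density \<open>q j\<close> may depend on \<open>j\<close> because the sets to be hit
  later are denser at higher dyadic levels.\<close>

lemma exists_sample_hitting_all:
  fixes B :: "'j \<Rightarrow> 'x set" and q :: "'j \<Rightarrow> real" and m :: nat
  assumes fin: "finite X" "finite J" and ne: "X \<noteq> {}"
    and B: "\<And>j. j \<in> J \<Longrightarrow> B j \<subseteq> X \<and> 0 \<le> q j \<and> q j * card X \<le> card (B j)"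
    and total: "(\<Sum>j\<in>J. exp (- (m * q j / 8))) < 1"
  obtains Q where "Q \<in> {..<m} \<rightarrow>\<^sub>E X"
    and "\<And>j. j \<in> J \<Longrightarrow> m * q j / 2 \<le> card {i. i < m \<and> Q i \<in> B j}"
proof -
  define Bad where "Bad j = {Q \<in> {..<m} \<rightarrow>\<^sub>E X. real (card {i. i < m \<and> Q i \<in> B j}) < m * q j / 2}" for j
  have finP: "finite ({..<m} \<rightarrow>\<^sub>E X)" using fin by (auto intro: finite_PiE)
  have "real (card (\<Union>j\<in>J. Bad j)) \<le> real (\<Sum>j\<in>J. card (Bad j))"
    using card_UN_le[OF fin(2)] of_nat_mono by blast
  also have "\<dots> \<le> (\<Sum>j\<in>J. card X ^ m * exp (- (m * q j / 8)))"
    unfolding of_nat_sum Bad_def using B fin by (intro sum_mono card_few_hits) auto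
  also have "\<dots> = card X ^ m * (\<Sum>j\<in>J. exp (- (m * q j / 8)))"
    by (simp add: sum_distrib_left)
  also have "\<dots> < real (card X ^ m) * 1"
    using total ne fin by (intro mult_strict_left_mono) (auto simp: card_gt_0_iff)
  also have "\<dots> = real (card ({..<m} \<rightarrow>\<^sub>E X))" by (simp add: card_PiE)
  finally have "card (\<Union>j\<in>J. Bad j) < card ({..<m} \<rightarrow>\<^sub>E X)" by simp
  moreover have "(\<Union>j\<in>J. Bad j) \<subseteq> {..<m} \<rightarrow>\<^sub>E X" by (auto simp: Bad_def)
  ultimately obtain Q where Q: "Q \<in> {..<m} \<rightarrow>\<^sub>E X" "Q \<notin> (\<Union>j\<in>J. Bad j)"
    by (metis order_less_irrefl subsetI subset_antisym)
  show thesis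
  proof
    show "Q \<in> {..<m} \<rightarrow>\<^sub>E X" by (rule Q)
    show "m * q j / 2 \<le> card {i. i < m \<and> Q i \<in> B j}" if "j \<in> J" for j
      using Q that by (auto simp: Bad_def not_less)
  qed
qed

text \<open>Maurey's empirical method.\<close>

lemma empirical_average:
  fixes p :: "'c pmf" and v :: "'x \<Rightarrow> 'c \<Rightarrow> real" and u :: "'x \<Rightarrow> real" and t :: nat and a :: real
  assumes fin: "finite X" "finite (set_pmf p)" and u: "\<And>x. x \<in> X \<Longrightarrow> 0 \<le> u x"
    and v: "\<And>x c. x \<in> X \<Longrightarrow> c \<in> set_pmf p \<Longrightarrow> \<bar>v x c\<bar> \<le> 1"
    and t: "0 < t" and a: "0 \<le> a"
  shows "\<exists>g. (\<forall>j<t. g j \<in> set_pmf p) \<and>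
    (\<Sum>x\<in>X. u x * of_bool (t * a \<le> \<bar>(\<Sum>j<t. v x (g j)) - t * measure_pmf.expectation p (v x)\<bar>))
           \<le> (\<Sum>x\<in>X. u x) * (2 * exp (- (t * a\<^sup>2 / 2)))"
proof -
  define P where "P = Pi_pmf {..<t} undefined (\<lambda>_. p)"
  define E where "E x = {g. t * a \<le> \<bar>(\<Sum>j<t. v x (g j)) - t * measure_pmf.expectation p (v x)\<bar>}" for x
  have setP: "set_pmf P = PiE_dflt {..<t} undefined (\<lambda>_. set_pmf p)"
    unfolding P_def by (subst set_Pi_pmf) (simp_all add: comp_def)
  have finP: "finite (set_pmf P)" using fin by (auto simp: setP)
  have comp: "map_pmf (\<lambda>g. g j) P = p" if "j < t" for j
    using that by (simp add: P_def Pi_pmf_component)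
  have prob: "measure_pmf.prob P (E x) \<le> 2 * exp (- (t * a\<^sup>2 / 2))" if x: "x \<in> X" for x
  proof -
    interpret Hoeffding_ineq "measure_pmf P" "{..<t}" "\<lambda>j g. v x (g j)" "\<lambda>_. -1" "\<lambda>_. 1"
      "\<Sum>j<t. measure_pmf.expectation P (\<lambda>g. v x (g j))"
    proof unfold_locales
      show "prob_space.indep_vars (measure_pmf P) (\<lambda>_. borel) (\<lambda>j g. v x (g j)) {..<t}"
        unfolding P_def
        by (intro prob_space.indep_vars_compose2[OF _ indep_vars_Pi_pmf])
          (auto simp: measure_pmf.prob_space_axioms)
      show "AE g in measure_pmf P. v x (g j) \<in> {- 1..1}" if "j \<in> {..<t}" for j
        using that v[OF x] by (fastforce simp: AE_measure_pmf_iff setP PiE_dflt_def abs_le_iff)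
    qed auto
    have "measure_pmf.expectation P (\<lambda>g. v x (g j)) = measure_pmf.expectation p (v x)" if "j < t" for j
      by (subst comp[OF that, symmetric]) (simp add: comp_def)
    then have "(\<Sum>j<t. measure_pmf.expectation P (\<lambda>g. v x (g j))) = t * measure_pmf.expectation p (v x)"
      by simp
    then have "measure_pmf.prob P (E x) \<le> 2 * exp (- 2 * (t * a)\<^sup>2 / (\<Sum>j<t. (1 - (-1))\<^sup>2))"
      using Hoeffding_ineq_abs_ge[of "t * a"] a t by (simp add: E_def)
    \<comment> \<open>Each summand has range width 2, so the squared widths add up to
      \<open>4 * t\<close>.\<close>
    also have "- 2 * (t * a)\<^sup>2 / (\<Sum>j<t. (1 - (-1))\<^sup>2) = - (t * a\<^sup>2 / 2)"
      using t by (simp add: power2_eq_square field_simps)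
    finally show ?thesis .
  qed
  let ?F = "\<lambda>g. \<Sum>x\<in>X. u x * indicator (E x) g"
  have "measure_pmf.expectation P ?F = (\<Sum>x\<in>X. u x * measure_pmf.prob P (E x))"
    by (subst Bochner_Integration.integral_sum)
      (auto intro: integrable_measure_pmf_finite finP)
  also have "\<dots> \<le> (\<Sum>x\<in>X. u x * (2 * exp (- (t * a\<^sup>2 / 2))))"
    by (intro sum_mono mult_left_mono prob u)
  finally have le: "measure_pmf.expectation P ?F \<le> (\<Sum>x\<in>X. u x) * (2 * exp (- (t * a\<^sup>2 / 2)))"
    by (simp add: sum_distrib_right)
  \<comment> \<open>Some draw does no worse than the average; taking it from the support keeps its
    first \<open>t\<close> entries in \<open>set_pmf p\<close>.\<close>
  have "\<exists>g\<in>set_pmf P. ?F g \<le> measure_pmf.expectation P ?F"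
  proof (rule ccontr)
    assume "\<not> ?thesis"
    then have "AE g in P. measure_pmf.expectation P ?F < ?F g"
      by (auto simp: AE_measure_pmf_iff)
    then have "measure_pmf.expectation P ?F < measure_pmf.expectation P ?F"
      by (intro measure_pmf.expectation_greater integrable_measure_pmf_finite finP)
    then show False by simp
  qed
  then obtain g where g: "g \<in> set_pmf P" "?F g \<le> (\<Sum>x\<in>X. u x) * (2 * exp (- (t * a\<^sup>2 / 2)))"
    using le by fastforce
  show ?thesis
  proof (intro exI conjI)
    show "\<forall>j<t. g j \<in> set_pmf p"
      using g by (auto simp: setP PiE_dflt_def)
    show "(\<Sum>x\<in>X. u x * of_bool (t * a \<le> \<bar>(\<Sum>j<t. v x (g j)) - t * measure_pmf.expectation p (v x)\<bar>))
           \<le> (\<Sum>x\<in>X. u x) * (2 * exp (- (t * a\<^sup>2 / 2)))"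
      using g(2) by (simp add: E_def indicator_def)
  qed
qed

section \<open>Upper bound\<close>

lemma exists_pmf_of_weights:
  fixes w :: "'a \<Rightarrow> real"
  assumes fin: "finite A" and w: "\<And>x. x \<in> A \<Longrightarrow> 0 \<le> w x" "(\<Sum>x\<in>A. w x) = 1"
  obtains p where "set_pmf p = {x \<in> A. w x \<noteq> 0}"
    and "\<And>f :: 'a \<Rightarrow> real. measure_pmf.expectation p f = (\<Sum>x\<in>A. w x * f x)"
proof -
  define w' where "w' x = (if x \<in> A then w x else 0)" for x
  have w'_nonneg: "0 \<le> w' x" for x using w by (simp add: w'_def)
  have "(\<integral>\<^sup>+x. ennreal (w' x) \<partial>count_space UNIV) = (\<Sum>x\<in>A. ennreal (w' x))"
    by (rule nn_integral_count_space') (auto simp: fin w'_def)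
  also have "\<dots> = ennreal (\<Sum>x\<in>A. w' x)" by (rule sum_ennreal) (rule w'_nonneg)
  also have "\<dots> = 1" using w by (simp add: w'_def)
  finally have 1: "(\<integral>\<^sup>+x. ennreal (w' x) \<partial>count_space UNIV) = 1" .
  have pmf: "pmf (embed_pmf w') x = w' x" for x
    by (rule pmf_embed_pmf) (simp_all add: w'_nonneg 1)
  have set: "set_pmf (embed_pmf w') = {x \<in> A. w x \<noteq> 0}"
    by (auto simp: set_pmf_eq pmf w'_def)
  show thesis
  proof
    show "set_pmf (embed_pmf w') = {x \<in> A. w x \<noteq> 0}" by (rule set)
    show "measure_pmf.expectation (embed_pmf w') f = (\<Sum>x\<in>A. w x * f x)" for f :: "'a \<Rightarrow> real"
      by (subst integral_measure_pmf_real[OF fin]) (auto simp: set pmf w'_def mult.commute)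
  qed
qed

text \<open>Parseval's identity: after expanding the square, only the diagonal survives
  orthogonality.\<close>

lemma sum_chi_expansion_square:
  assumes "U \<subseteq> Pow {1..n}"
  shows "(\<Sum>x\<in>cube n. (\<Sum>S\<in>U. \<theta> S * chi S x)\<^sup>2) = 2 ^ n * (\<Sum>S\<in>U. (\<theta> S)\<^sup>2)"
proof -
  have fin: "finite U" using assms by (rule finite_subset) simp
  have "(\<Sum>x\<in>cube n. (\<Sum>S\<in>U. \<theta> S * chi S x)\<^sup>2)
      = (\<Sum>x\<in>cube n. \<Sum>S\<in>U. \<Sum>T\<in>U. \<theta> S * \<theta> T * (chi S x * chi T x))"
    by (simp add: power2_eq_square sum_product algebra_simps)
  also have "\<dots> = (\<Sum>S\<in>U. \<Sum>T\<in>U. \<theta> S * \<theta> T * (\<Sum>x\<in>cube n. chi S x * chi T x))"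
    by (subst sum.swap, rule sum.cong[OF refl], subst sum.swap) (simp add: sum_distrib_left)
  also have "\<dots> = (\<Sum>S\<in>U. \<Sum>T\<in>U. if S = T then 2 ^ n * (\<theta> S)\<^sup>2 else 0)"
  proof (intro sum.cong refl)
    fix S T assume "S \<in> U" "T \<in> U"
    then have "S \<subseteq> {1..n}" "T \<subseteq> {1..n}" using assms by auto
    then show "\<theta> S * \<theta> T * (\<Sum>x\<in>cube n. chi S x * chi T x) = (if S = T then 2 ^ n * (\<theta> S)\<^sup>2 else 0)"
      by (simp only: sum_chi_mult_chi) (simp add: power2_eq_square)
  qed
  also have "\<dots> = 2 ^ n * (\<Sum>S\<in>U. (\<theta> S)\<^sup>2)"
    by (simp add: fin sum_distrib_left)
  finally show ?thesis .
qed

text \<open>Pigeonhole over scales. Values below \<open>2^-L\<close> carry at most half of the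
  energy, since \<open>2 * k <= 4 ^ L\<close>. One of the \<open>L\<close> levels must carry its
  share \<open>1 / (2 * k * L)\<close> of the mean square, and a point counted at level
  \<open>i\<close> accounts for at most \<open>4 / 4 ^ i\<close>.\<close>

lemma exists_dyadic_level:
  fixes F :: "'x \<Rightarrow> real" and k L :: nat
  assumes fin: "finite X" and bound: "\<And>x. x \<in> X \<Longrightarrow> \<bar>F x\<bar> \<le> 1"
    and k: "0 < k" "2 * k \<le> 4 ^ L" and L: "0 < L" and ne: "X \<noteq> {}"
    and energy: "card X / k \<le> (\<Sum>x\<in>X. (F x)\<^sup>2)"
  obtains i where "1 \<le> i" "i \<le> L"
    and "4 ^ i / (8 * k * L) * card X \<le> card {x \<in> X. (1/2) ^ i \<le> \<bar>F x\<bar>}"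
proof -
  let ?c = "\<lambda>i. real (card {x \<in> X. (1/2) ^ i \<le> \<bar>F x\<bar>})"
  have pointwise: "(F x)\<^sup>2 \<le> 1 / 4 ^ L + (\<Sum>i=1..L. 4 / 4 ^ i * of_bool ((1/2) ^ i \<le> \<bar>F x\<bar>))"
    if x: "x \<in> X" for x
  proof (cases "(1/2) ^ L \<le> \<bar>F x\<bar>")
    case True
    \<comment> \<open>At the least level reached, the previous level fails, so \<open>F x\<close> is
      at most twice \<open>2^-i\<close> in absolute value; for \<open>i = 1\<close> the bound 1 on
      \<open>F\<close> does this.\<close>
    define i where "i = (LEAST i. 1 \<le> i \<and> (1/2) ^ i \<le> \<bar>F x\<bar>)"
    have i: "1 \<le> i \<and> (1/2) ^ i \<le> \<bar>F x\<bar>"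
      unfolding i_def by (rule LeastI[of _ L]) (use True L in auto)
    have iL: "i \<le> L" unfolding i_def by (rule Least_le) (use True L in auto)
    have "\<bar>F x\<bar> \<le> 2 * (1/2) ^ i"
    proof (cases "i = 1")
      case True
      then show ?thesis using bound[OF x] by simp
    next
      case False
      with i obtain l where l: "i = Suc l" "1 \<le> l" by (cases i) auto
      then have "\<not> (1/2) ^ l \<le> \<bar>F x\<bar>"
        using not_less_Least[of l "\<lambda>i. 1 \<le> i \<and> (1/2) ^ i \<le> \<bar>F x\<bar>", folded i_def] by simp
      then show ?thesis using l by simp
    qed
    then have "\<bar>F x\<bar>\<^sup>2 \<le> (2 * (1/2) ^ i)\<^sup>2" by (intro power_mono) auto
    also have "\<dots> = 4 / 4 ^ i"
      by (simp add: power2_eq_square power_divide flip: power_mult_distrib)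
    also have "\<dots> \<le> (\<Sum>i=1..L. 4 / 4 ^ i * of_bool ((1/2) ^ i \<le> \<bar>F x\<bar>))"
      using i iL by (intro order_trans[OF _ member_le_sum[of i]]) auto
    finally show ?thesis by (simp add: add_increasing)
  next
    case False
    then have "\<bar>F x\<bar>\<^sup>2 \<le> ((1/2) ^ L)\<^sup>2" by (intro power_mono) auto
    also have "\<dots> = 1 / 4 ^ L"
      by (simp add: power2_eq_square power_divide flip: power_mult_distrib)
    finally show ?thesis by (simp add: add_increasing2 sum_nonneg)
  qed
  have "\<exists>i\<in>{1..L}. 4 ^ i / (8 * k * L) * card X \<le> ?c i"
  proof (rule ccontr)
    assume "\<not> ?thesis"
    then have less: "?c i < 4 ^ i / (8 * k * L) * card X" if "i \<in> {1..L}" for i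
      using that by (auto simp: not_le)
    have "card X / k \<le> (\<Sum>x\<in>X. 1 / 4 ^ L + (\<Sum>i=1..L. 4 / 4 ^ i * of_bool ((1/2) ^ i \<le> \<bar>F x\<bar>)))"
      using energy pointwise by (meson order_trans sum_mono)
    also have "\<dots> = card X / 4 ^ L + (\<Sum>i=1..L. 4 / 4 ^ i * (\<Sum>x\<in>X. of_bool ((1/2) ^ i \<le> \<bar>F x\<bar>)))"
      by (subst sum.distrib, subst sum.swap) (simp add: sum_distrib_left)
    also have "\<dots> = card X / 4 ^ L + (\<Sum>i=1..L. 4 / 4 ^ i * ?c i)"
      using fin by (simp add: of_bool_def sum.If_cases Int_def)
    also have "\<dots> < card X / (2 * k) + (\<Sum>i=1..L. 4 / 4 ^ i * (4 ^ i / (8 * k * L) * card X))"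
    proof (rule add_le_less_mono)
      have "real (2 * k) \<le> 4 ^ L" using k by (metis of_nat_le_iff of_nat_numeral of_nat_power)
      then show "card X / 4 ^ L \<le> card X / (2 * k)" using k by (intro divide_left_mono) auto
      show "(\<Sum>i=1..L. 4 / 4 ^ i * ?c i) < (\<Sum>i=1..L. 4 / 4 ^ i * (4 ^ i / (8 * k * L) * card X))"
        using L less by (intro sum_strict_mono mult_strict_left_mono) auto
    qed
    also have "\<dots> = card X / k"
      using k L by (simp add: field_simps)
    finally show False by simp
  qed
  then show thesis using that by auto
qed

text \<open>Why \<open>k n log\<^sup>2 k\<close> points suffice: an \<open>f\<close> concentrated on a small set has large values there, and
  large values survive a crude approximation by a short average, of which there are few. This is
  the argument of Bourgain and of Haviv and Regev for the restricted isometry property.\<close>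

lemma exists_uniqueness_set:
  fixes n k L T m :: nat
  assumes k: "0 < k" "2 * k \<le> 4 ^ L" and L: "0 < L" and T: "8 * ln (25 * k * L) \<le> T"
    and m: "m = 256 * k * L * (n + 1) * T"
  obtains Q where "Q \<in> {..<m} \<rightarrow>\<^sub>E cube n"
    and "\<And>\<theta>. {S \<in> Pow {1..n}. \<theta> S \<noteq> 0} \<noteq> {} \<Longrightarrow> card {S \<in> Pow {1..n}. \<theta> S \<noteq> 0} \<le> k \<Longrightarrow>
      \<exists>j<m. (\<Sum>S\<in>Pow {1..n}. \<theta> S * chi S (Q j)) \<noteq> 0"
proof -
  \<comment> \<open>Accuracy of order \<open>2^-i\<close> takes about \<open>4 ^ i\<close> draws, up
    to the logarithmic factor \<open>T\<close>. The density \<open>p i\<close> supplied by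
    \<open>exists_dyadic_level\<close> grows at the same rate.\<close>
  define t where "t i = 4 ^ i * T" for i :: nat
  define p :: "nat \<Rightarrow> real" where "p i = 4 ^ i / (8 * k * L)" for i
  \<comment> \<open>\<open>H i\<close> lists codes for sums of \<open>t i\<close> signed characters,
    and \<open>J\<close> keeps the codes whose sum is large on a set of density at least
    \<open>p i / 2\<close>. The union bound thus runs over finitely many codes instead of all
    \<open>\<theta>\<close>.\<close>
  define H where "H i = {..<t i} \<rightarrow>\<^sub>E ({-1, 1::real} \<times> Pow {1..n})" for i
  define G where "G i h x = (\<Sum>j<t i. fst (h j) * chi (snd (h j)) x)"
    for i and h :: "nat \<Rightarrow> real \<times> nat set" and x
  define B where "B i h = {x \<in> cube n. t i * ((1/2) ^ i / 2) < \<bar>G i h x\<bar>}" for i h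
  define J where "J = (SIGMA i:{1..L}. {h \<in> H i. p i / 2 * 2 ^ n \<le> card (B i h)})"
  have "1 \<le> k * L" using k L by simp
  then have kL: "1 \<le> real k * real L" by (simp only: of_nat_mult[symmetric] of_nat_1_eq_iff one_of_nat_le_iff)
  have p_pos: "0 < p i" for i using k L by (simp add: p_def)
  have finH: "finite (H i)" for i by (auto simp: H_def intro!: finite_PiE)
  have cardH: "card (H i) = 2 ^ ((n + 1) * t i)" for i
  proof -
    have "card ({-1, 1::real} \<times> Pow {1..n}) = 2 ^ (n + 1)"
      by (simp add: card_cartesian_product card_Pow)
    then show ?thesis by (simp only: H_def card_funcsetE[OF finite_lessThan] card_lessThan power_mult)
  qed
  have "0 < ln (25 * real k * real L)" using kL by (intro ln_gt_zero) simp
  then have T1: "ln (25 * k * L) \<le> T" "0 < T" using T by auto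
  \<comment> \<open>There are at most \<open>exp ((n + 1) * t i)\<close> codes at level
    \<open>i\<close>, against a failure bound \<open>exp (- 2 * (n + 1) * t i)\<close> for each. In
    \<open>m * p i\<close> the factor \<open>4 ^ i\<close> matches that of \<open>t i\<close>, so
    one \<open>m\<close> serves all levels. What remains is at most \<open>1 / (25 * k * L)\<close>
    per level.\<close>
  have total: "(\<Sum>j\<in>J. exp (- (m * (p (fst j) / 2) / 8))) < 1"
  proof -
    have "(\<Sum>j\<in>J. exp (- (m * (p (fst j) / 2) / 8)))
        = (\<Sum>i=1..L. \<Sum>h | h \<in> H i \<and> p i / 2 * 2 ^ n \<le> card (B i h). exp (- (m * (p i / 2) / 8)))"
      unfolding J_def using finH by (subst sum.Sigma) (auto simp: split_beta)
    also have "\<dots> \<le> (\<Sum>i=1..L. 1 / (25 * k * L))"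
    proof (rule sum_mono)
      fix i assume i: "i \<in> {1..L}"
      have mp: "m * (p i / 2) / 8 = 2 * (real (n + 1) * t i)"
        using k L by (simp add: m p_def t_def field_simps)
      have "(\<Sum>h | h \<in> H i \<and> p i / 2 * 2 ^ n \<le> card (B i h). exp (- (m * (p i / 2) / 8)))
          \<le> real (card (H i)) * exp (- (m * (p i / 2) / 8))"
        using finH by (auto intro!: mult_right_mono card_mono)
      also have "real (card (H i)) \<le> exp 1 ^ ((n + 1) * t i)"
        unfolding cardH of_nat_power using exp_ge_add_one_self[of 1] by (intro power_mono) auto
      also have "exp 1 ^ ((n + 1) * t i) = exp (real (n + 1) * t i)"
        by (simp only: exp_of_nat_mult[symmetric] of_nat_mult mult_1_right)
      finally have "(\<Sum>h | h \<in> H i \<and> p i / 2 * 2 ^ n \<le> card (B i h). exp (- (m * (p i / 2) / 8)))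
          \<le> exp (real (n + 1) * t i) * exp (- (2 * (real (n + 1) * t i)))"
        unfolding mp by simp
      also have "\<dots> = exp (- real ((n + 1) * t i))" by (simp add: exp_add[symmetric] algebra_simps)
      also have "\<dots> \<le> exp (- real T)"
      proof -
        have "1 * (1 * T) \<le> (n + 1) * t i" unfolding t_def by (intro mult_le_mono) auto
        then have "T \<le> (n + 1) * t i" by simp
        then show ?thesis by (simp only: exp_le_cancel_iff neg_le_iff_le of_nat_le_iff)
      qed
      also have "\<dots> \<le> exp (- ln (25 * k * L))" using T1 by simp
      also have "\<dots> = 1 / (25 * k * L)" using k L by (simp add: exp_minus inverse_eq_divide)
      finally show "(\<Sum>h | h \<in> H i \<and> p i / 2 * 2 ^ n \<le> card (B i h). exp (- (m * (p i / 2) / 8)))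
          \<le> 1 / (25 * k * L)" .
    qed
    also have "\<dots> = 1 / (25 * k)" using L by simp
    also have "\<dots> < 1" using k by simp
    finally show ?thesis .
  qed
  obtain Q where Q: "Q \<in> {..<m} \<rightarrow>\<^sub>E cube n"
    and hit: "\<And>j. j \<in> J \<Longrightarrow> m * (p (fst j) / 2) / 2 \<le> card {l. l < m \<and> Q l \<in> (case_prod B) j}"
  proof (rule exists_sample_hitting_all[where B = "case_prod B" and X = "cube n" and J = J
        and q = "\<lambda>j. p (fst j) / 2" and m = m])
    show "finite J" unfolding J_def using finH by auto
    show "case_prod B j \<subseteq> cube n \<and> 0 \<le> p (fst j) / 2 \<and>
        p (fst j) / 2 * card (cube n) \<le> card (case_prod B j)" if "j \<in> J" for j
      using that p_pos[of "fst j"] by (auto simp: J_def B_def card_cube)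
  qed (use total that in auto)
  have "\<exists>j<m. (\<Sum>S\<in>Pow {1..n}. \<theta> S * chi S (Q j)) \<noteq> 0"
    if ne: "{S \<in> Pow {1..n}. \<theta> S \<noteq> 0} \<noteq> {}" and card: "card {S \<in> Pow {1..n}. \<theta> S \<noteq> 0} \<le> k" for \<theta>
  proof -
    define U where "U = {S \<in> Pow {1..n}. \<theta> S \<noteq> 0}"
    have U: "finite U" "U \<subseteq> Pow {1..n}" "U \<noteq> {}" "card U \<le> k" using ne card by (auto simp: U_def)
    \<comment> \<open>With coefficients scaled to absolute sum 1, \<open>f\<close> is the mean of a
      signed character drawn with probability \<open>\<bar>\<theta> S\<bar> / W\<close>.\<close>
    define W where "W = (\<Sum>S\<in>U. \<bar>\<theta> S\<bar>)"
    have W: "0 < W" unfolding W_def using U by (intro sum_pos) (auto simp: U_def)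
    define f where "f x = (\<Sum>S\<in>U. \<theta> S / W * chi S x)" for x
    have f_eq: "(\<Sum>S\<in>Pow {1..n}. \<theta> S * chi S x) = W * f x" for x
      unfolding f_def using W
      by (auto simp: U_def sum_distrib_left intro!: sum.mono_neutral_cong_right)
    have norm1: "(\<Sum>S\<in>U. \<bar>\<theta> S\<bar> / W) = 1" using W by (simp add: W_def sum_divide_distrib[symmetric])
    obtain P where setP: "set_pmf P = {S \<in> U. \<bar>\<theta> S\<bar> / W \<noteq> 0}"
      and exP: "\<And>v. measure_pmf.expectation P v = (\<Sum>S\<in>U. \<bar>\<theta> S\<bar> / W * v S)"
      using exists_pmf_of_weights[OF U(1), of "\<lambda>S. \<bar>\<theta> S\<bar> / W"] W norm1 by auto
    define v where "v x S = sgn (\<theta> S) * chi S x" for x S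
    have ex_v: "measure_pmf.expectation P (v x) = f x" for x
      unfolding exP v_def f_def by (rule sum.cong) (auto simp: sgn_real_def abs_real_def)
    have abs_v: "\<bar>v x S\<bar> \<le> 1" if "x \<in> cube n" "S \<in> U" for x S
      using abs_chi[OF that(1), of S] that(2) U by (auto simp: v_def abs_mult abs_sgn_eq)
    have abs_f: "\<bar>f x\<bar> \<le> 1" if x: "x \<in> cube n" for x
    proof -
      have "\<bar>f x\<bar> \<le> (\<Sum>S\<in>U. \<bar>\<theta> S / W * chi S x\<bar>)" unfolding f_def by (rule sum_abs)
      also have "\<dots> = (\<Sum>S\<in>U. \<bar>\<theta> S\<bar> / W)"
        using U W abs_chi[OF x] by (intro sum.cong) (auto simp: abs_mult)
      finally show ?thesis using norm1 by simp
    qed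
    \<comment> \<open>Cauchy-Schwarz over at most \<open>k\<close> terms turns absolute sum 1 into
      square sum at least \<open>1 / k\<close>; Parseval transfers this to the cube.\<close>
    have energy: "card (cube n) / k \<le> (\<Sum>x\<in>cube n. (f x)\<^sup>2)"
    proof -
      have "(\<Sum>S\<in>U. \<bar>\<theta> S\<bar> / W)\<^sup>2 \<le> (\<Sum>S\<in>U. (\<bar>\<theta> S\<bar> / W)\<^sup>2) * card U"
        using Cauchy_Schwarz_ineq_sum[of "\<lambda>S. \<bar>\<theta> S\<bar> / W" "\<lambda>_. 1" U] by simp
      also have "\<dots> \<le> (\<Sum>S\<in>U. (\<bar>\<theta> S\<bar> / W)\<^sup>2) * k"
        using U by (intro mult_left_mono sum_nonneg) auto
      finally have "1 / k \<le> (\<Sum>S\<in>U. (\<theta> S / W)\<^sup>2)"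
        using k by (simp add: norm1 field_simps power_divide)
      then have "2 ^ n * (1 / k) \<le> 2 ^ n * (\<Sum>S\<in>U. (\<theta> S / W)\<^sup>2)" by (intro mult_left_mono) auto
      also have "\<dots> = (\<Sum>x\<in>cube n. (f x)\<^sup>2)"
        unfolding f_def by (rule sum_chi_expansion_square[OF U(2), symmetric])
      finally show ?thesis by (simp add: card_cube)
    qed
    obtain i where i: "1 \<le> i" "i \<le> L"
      and level: "p i * 2 ^ n \<le> card {x \<in> cube n. (1/2) ^ i \<le> \<bar>f x\<bar>}"
      using exists_dyadic_level[of "cube n" f k L] abs_f energy k L
      by (auto simp: p_def card_cube)
    \<comment> \<open>Half the level: an average within \<open>a\<close> of a value of size at least
      \<open>2 * a\<close> still exceeds \<open>a\<close>, and an average exceeding \<open>a\<close>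
      certifies a nonzero value.\<close>
    define a :: real where "a = (1/2) ^ i / 2"
    have ti: "0 < t i" using T1 by (simp add: t_def)
    have m_pos: "0 < m" using k L T1 by (simp add: m)
    \<comment> \<open>A single draw \<open>g\<close> has to be accurate on the cube and on the
      sample, so both are joined in a disjoint sum. The weights are scaled so that bad weight below
      1 forces bad fractions below \<open>p i / 2\<close> on the cube and below
      \<open>p i / 4\<close> on the sample.\<close>
    define pt where "pt = case_sum id Q"
    define u :: "point + nat \<Rightarrow> real"
      where "u = case_sum (\<lambda>_. 2 / (p i * 2 ^ n)) (\<lambda>_. 4 / (p i * m))"
    define bad where "bad g x \<longleftrightarrow> t i * a \<le> \<bar>(\<Sum>j<t i. v x (g j)) - t i * f x\<bar>" for g x
    have u_nonneg: "0 \<le> u y" if "y \<in> cube n <+> {..<m}" for y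
      using p_pos[of i] by (cases y) (simp_all add: u_def)
    have v_pt: "\<bar>v (pt y) S\<bar> \<le> 1" if "y \<in> cube n <+> {..<m}" "S \<in> set_pmf P" for y S
    proof (rule abs_v)
      show "pt y \<in> cube n" using that(1) PiE_mem[OF Q] by (elim PlusE) (simp_all add: pt_def)
      show "S \<in> U" using that(2) by (simp add: setP)
    qed
    have fin: "finite (cube n <+> {..<m})" "finite (set_pmf P)" using U by (simp_all add: setP)
    have a: "0 \<le> a" by (simp add: a_def)
    have "\<exists>g. (\<forall>j<t i. g j \<in> set_pmf P) \<and>
        (\<Sum>y\<in>cube n <+> {..<m}. u y * of_bool (t i * a \<le>
          \<bar>(\<Sum>j<t i. v (pt y) (g j)) - t i * measure_pmf.expectation P (v (pt y))\<bar>))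
        \<le> (\<Sum>y\<in>cube n <+> {..<m}. u y) * (2 * exp (- (t i * a\<^sup>2 / 2)))"
      by (rule empirical_average[where v = "\<lambda>y. v (pt y)" and u = u, OF fin u_nonneg v_pt ti a])
    then obtain g where g: "\<forall>j<t i. g j \<in> set_pmf P"
      and "(\<Sum>y\<in>cube n <+> {..<m}. u y * of_bool (t i * a \<le>
          \<bar>(\<Sum>j<t i. v (pt y) (g j)) - t i * measure_pmf.expectation P (v (pt y))\<bar>))
        \<le> (\<Sum>y\<in>cube n <+> {..<m}. u y) * (2 * exp (- (t i * a\<^sup>2 / 2)))"
      by (elim exE conjE)
    then have avg: "(\<Sum>y\<in>cube n <+> {..<m}. u y * of_bool (bad g (pt y)))
        \<le> (\<Sum>y\<in>cube n <+> {..<m}. u y) * (2 * exp (- (t i * a\<^sup>2 / 2)))"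
      by (simp only: ex_v bad_def)
    \<comment> \<open>The total weight is \<open>2 / p i + 4 / p i\<close>. The constant 25 makes
      the bound \<open>96 / (25 * 4 ^ i)\<close>, which is below 1 from \<open>i = 1\<close>
      on.\<close>
    have "(\<Sum>y\<in>cube n <+> {..<m}. u y) * (2 * exp (- (t i * a\<^sup>2 / 2))) < 1"
    proof -
      have sq: "a\<^sup>2 = 1 / (4 * 4 ^ i)"
        by (simp add: a_def power2_eq_square power_divide flip: power_mult_distrib)
      have weight: "(\<Sum>y\<in>cube n <+> {..<m}. u y) = 6 / p i"
        using p_pos[of i] m_pos by (simp add: u_def sum.Plus card_cube field_simps)
      have "t i * a\<^sup>2 / 2 = T / 8"
        by (simp add: t_def sq)
      then have "exp (- (t i * a\<^sup>2 / 2)) \<le> exp (- ln (25 * k * L))" using T by simp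
      also have "\<dots> = 1 / (25 * k * L)"
        using k L by (simp add: exp_minus inverse_eq_divide)
      finally have tail: "exp (- (t i * a\<^sup>2 / 2)) \<le> 1 / (25 * k * L)" .
      have "(\<Sum>y\<in>cube n <+> {..<m}. u y) * (2 * exp (- (t i * a\<^sup>2 / 2)))
          \<le> 6 / p i * (2 * (1 / (25 * k * L)))"
        unfolding weight using tail p_pos[of i] by (intro mult_left_mono) auto
      also have "\<dots> = 96 / (25 * 4 ^ i)" using k L by (simp add: p_def field_simps)
      also have "\<dots> < 1"
      proof -
        have "(4::real) ^ 1 \<le> 4 ^ i" using i by (intro power_increasing) auto
        then show ?thesis by simp
      qed
      finally show ?thesis .
    qed
    with avg have "(\<Sum>y\<in>cube n <+> {..<m}. u y * of_bool (bad g (pt y))) < 1"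
      by (rule le_less_trans)
    moreover have "(\<Sum>y\<in>cube n <+> {..<m}. u y * of_bool (bad g (pt y)))
        = (\<Sum>x\<in>cube n. of_bool (bad g x)) * (2 / (p i * 2 ^ n))
          + (\<Sum>j<m. of_bool (bad g (Q j))) * (4 / (p i * m))"
      by (subst sum.Plus) (simp_all add: u_def pt_def mult.commute flip: sum_distrib_left sum_divide_distrib)
    moreover have "(\<Sum>x\<in>cube n. of_bool (bad g x)) = real (card {x \<in> cube n. bad g x})"
      "(\<Sum>j<m. of_bool (bad g (Q j))) = real (card {j. j < m \<and> bad g (Q j)})"
      by (simp_all add: Int_def)
    ultimately have small: "card {x \<in> cube n. bad g x} * (2 / (p i * 2 ^ n))
        + card {j. j < m \<and> bad g (Q j)} * (4 / (p i * m)) < 1"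
      by simp
    have nn: "0 \<le> card {x \<in> cube n. bad g x} * (2 / (p i * 2 ^ n))"
      "0 \<le> card {j. j < m \<and> bad g (Q j)} * (4 / (p i * m))" using p_pos[of i] by auto
    have bad_cube: "card {x \<in> cube n. bad g x} < p i * 2 ^ n / 2"
    proof -
      have "card {x \<in> cube n. bad g x} * (2 / (p i * 2 ^ n)) < 1" using small nn by linarith
      then show ?thesis using p_pos[of i] by (simp add: field_simps)
    qed
    have bad_sample: "card {j. j < m \<and> bad g (Q j)} < p i * m / 4"
    proof -
      have "card {j. j < m \<and> bad g (Q j)} * (4 / (p i * m)) < 1" using small nn by linarith
      then show ?thesis using p_pos[of i] m_pos by (simp add: field_simps)
    qed
    \<comment> \<open>The draw becomes a code in \<open>H i\<close>: its sets lie in the support of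
      \<open>\<theta>\<close>, so the recorded signs are never 0.\<close>
    define h where "h = (\<lambda>j\<in>{..<t i}. (sgn (\<theta> (g j)), g j))"
    have h: "h \<in> H i"
      unfolding h_def H_def restrict_PiE_iff
    proof
      fix j assume "j \<in> {..<t i}"
      then have "g j \<in> U" using g by (simp add: setP)
      then have "g j \<in> Pow {1..n}" "\<theta> (g j) \<noteq> 0" by (auto simp: U_def)
      then show "(sgn (\<theta> (g j)), g j) \<in> {-1, 1} \<times> Pow {1..n}"
        by (simp add: sgn_real_def)
    qed
    have G_h: "G i h x = (\<Sum>j<t i. v x (g j))" for x
      by (simp add: G_def h_def v_def)
    have B_h: "{x \<in> cube n. (1/2) ^ i \<le> \<bar>f x\<bar>} - {x \<in> cube n. bad g x} \<subseteq> B i h"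
    proof
      fix x assume x: "x \<in> {x \<in> cube n. (1/2) ^ i \<le> \<bar>f x\<bar>} - {x \<in> cube n. bad g x}"
      then have "t i * (2 * a) \<le> t i * \<bar>f x\<bar>" by (intro mult_left_mono) (auto simp: a_def)
      then have "t i * (2 * a) \<le> \<bar>t i * f x\<bar>" by (simp add: abs_mult)
      moreover have "\<bar>G i h x - t i * f x\<bar> < t i * a" using x by (auto simp: bad_def G_h)
      ultimately have "t i * a < \<bar>G i h x\<bar>" by argo
      then show "x \<in> B i h" using x by (simp add: B_def a_def)
    qed
    have "p i / 2 * 2 ^ n \<le> card {x \<in> cube n. (1/2) ^ i \<le> \<bar>f x\<bar>} - real (card {x \<in> cube n. bad g x})"
      using level bad_cube by simp
    also have "\<dots> \<le> card ({x \<in> cube n. (1/2) ^ i \<le> \<bar>f x\<bar>} - {x \<in> cube n. bad g x})"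
      using diff_card_le_card_Diff[of "{x \<in> cube n. bad g x}" "{x \<in> cube n. (1/2) ^ i \<le> \<bar>f x\<bar>}"] by simp
    also have "\<dots> \<le> card (B i h)"
      using B_h by (intro of_nat_mono card_mono) (auto simp: B_def)
    finally have "h \<in> {h \<in> H i. p i / 2 * 2 ^ n \<le> card (B i h)}" using h by blast
    moreover have "i \<in> {1..L}" using i by simp
    ultimately have "(i, h) \<in> J" unfolding J_def by (rule SigmaI[rotated])
    \<comment> \<open>The sample meets \<open>B i h\<close> more often than it meets bad points, so
      some sample point has a large average that is also accurate; \<open>f\<close> cannot vanish
      there.\<close>
    from hit[OF this] have "m * p i / 4 \<le> card {l. l < m \<and> Q l \<in> B i h}" by simp
    with bad_sample have "card {j. j < m \<and> bad g (Q j)} < card {l. l < m \<and> Q l \<in> B i h}"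
      by (simp add: mult.commute)
    then have "\<not> {l. l < m \<and> Q l \<in> B i h} \<subseteq> {j. j < m \<and> bad g (Q j)}"
      using card_mono[of "{j. j < m \<and> bad g (Q j)}" "{l. l < m \<and> Q l \<in> B i h}"] by simp (rule notI, simp)
    then obtain j where j: "j < m" "Q j \<in> B i h" "\<not> bad g (Q j)" by auto
    then have "t i * a < \<bar>G i h (Q j)\<bar>" "\<bar>G i h (Q j) - t i * f (Q j)\<bar> < t i * a"
      by (auto simp: B_def a_def bad_def G_h)
    then have "f (Q j) \<noteq> 0" by auto
    then have "(\<Sum>S\<in>Pow {1..n}. \<theta> S * chi S (Q j)) \<noteq> 0" unfolding f_eq using W by simp
    then show ?thesis using j(1) by (intro exI conjI)
  qed
  with Q show thesis by (rule that)
qed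

section \<open>From uniqueness sets to a query learner\<close>

lemma transcript_nonadaptive:
  assumes "\<And>h. length h < m \<Longrightarrow> q h = Q (length h)" "t \<le> m"
  shows "transcript q f t = map (\<lambda>j. (Q j, f (Q j))) [0..<t]"
  using assms(2) by (induction t) (simp_all add: assms(1) Let_def)

text \<open>A deterministic learner asks the points in order and returns a member of
  \<open>F\<close> consistent with the answers. By injectivity this is the target itself, so the
  failure event is empty.\<close>

lemma query_complexity_le_of_identifying_points:
  assumes Q: "\<And>j. j < m \<Longrightarrow> Q j \<in> cube n"
    and inj: "\<And>f g. f \<in> F \<Longrightarrow> g \<in> F \<Longrightarrow> \<forall>j<m. f (Q j) = g (Q j) \<Longrightarrow> f = g"
    and "0 < \<epsilon>" "0 \<le> \<delta>"
  shows "query_complexity n F \<epsilon> \<delta> \<le> ereal (real m)"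
proof -
  obtain x0 where x0: "x0 \<in> cube n" using cube_nonempty by blast
  \<comment> \<open>The rule must return a cube point on every history, so \<open>x0\<close> covers
    those of length at least \<open>m\<close>.\<close>
  define q where "q h = (if length h < m then Q (length h) else x0)" for h :: history
  define H where "H f = map (\<lambda>j. (Q j, f (Q j))) [0..<m]" for f :: "point \<Rightarrow> real"
  define e where "e h = (SOME f. f \<in> F \<and> H f = h)" for h
  define M :: "real measure" where "M = return borel 0"
  have "learner n M (\<lambda>_. q) (\<lambda>_. e)"
    unfolding learner_def
  proof (intro conjI allI ballI)
    show "prob_space M" unfolding M_def by (rule prob_space_return) simp
    show "(\<lambda>\<omega>. q h) \<in> M \<rightarrow>\<^sub>M count_space (cube n)" for h
      by (rule measurable_const) (simp add: q_def Q x0)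
  qed simp
  moreover have "failure_prob n m M (\<lambda>_. q) (\<lambda>_. e) \<epsilon> f \<le> \<delta>" if f: "f \<in> F" for f
  proof -
    have "transcript q f m = H f"
      unfolding H_def by (rule transcript_nonadaptive[where m = m]) (simp_all add: q_def)
    moreover have "e (H f) = f"
    proof -
      have "e (H f) \<in> F \<and> H (e (H f)) = H f" unfolding e_def by (rule someI[of _ f]) (simp add: f)
      then show ?thesis by (intro inj f) (auto simp: H_def)
    qed
    moreover have "linf n (\<lambda>x. 0) = 0" by (simp add: linf_def image_constant_conv)
    ultimately show ?thesis using assms by (simp add: failure_prob_def)
  qed
  ultimately show ?thesis
    unfolding query_complexity_def by (intro INF_lower) blast
qed

text \<open>The difference of two targets has at most \<open>2 * s\<close> nonzero coefficients, so
  targets with equal answers have equal coefficients.\<close>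

lemma query_complexity_sparse_class_le_of_uniqueness:
  assumes Q: "\<And>j. j < m \<Longrightarrow> Q j \<in> cube n"
    and uniq: "\<And>\<theta>. {S \<in> Pow {1..n}. \<theta> S \<noteq> 0} \<noteq> {} \<Longrightarrow>
      card {S \<in> Pow {1..n}. \<theta> S \<noteq> 0} \<le> 2 * s \<Longrightarrow>
      \<exists>j<m. (\<Sum>S\<in>Pow {1..n}. \<theta> S * chi S (Q j)) \<noteq> 0"
    and "0 < \<epsilon>" "0 \<le> \<delta>"
  shows "query_complexity n (sparse_class n s) \<epsilon> \<delta> \<le> ereal (real m)"
proof (rule query_complexity_le_of_identifying_points[OF Q])
  fix f g assume fg: "f \<in> sparse_class n s" "g \<in> sparse_class n s" and eq: "\<forall>j<m. f (Q j) = g (Q j)"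
  obtain \<theta> where f: "f = (\<lambda>x\<in>cube n. \<Sum>S\<in>Pow {1..n}. \<theta> S * chi S x)"
    and card_f: "card {S \<in> Pow {1..n}. \<theta> S \<noteq> 0} \<le> s"
    using fg(1) unfolding sparse_class_def mem_Collect_eq by (elim exE conjE)
  obtain \<eta> where g: "g = (\<lambda>x\<in>cube n. \<Sum>S\<in>Pow {1..n}. \<eta> S * chi S x)"
    and card_g: "card {S \<in> Pow {1..n}. \<eta> S \<noteq> 0} \<le> s"
    using fg(2) unfolding sparse_class_def mem_Collect_eq by (elim exE conjE)
  let ?D = "{S \<in> Pow {1..n}. \<theta> S - \<eta> S \<noteq> 0}"
  have "card ?D \<le> card ({S \<in> Pow {1..n}. \<theta> S \<noteq> 0} \<union> {S \<in> Pow {1..n}. \<eta> S \<noteq> 0})"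
    by (rule card_mono) auto
  also have "\<dots> \<le> 2 * s" 
    using card_f card_g card_Un_le[of "{S \<in> Pow {1..n}. \<theta> S \<noteq> 0}" "{S \<in> Pow {1..n}. \<eta> S \<noteq> 0}"]
    by linarith
  finally have le: "card ?D \<le> 2 * s" .
  have "(\<Sum>S\<in>Pow {1..n}. (\<theta> S - \<eta> S) * chi S (Q j)) = 0" if "j < m" for j
  proof -
    have "f (Q j) = g (Q j)" using eq that by blast
    then show ?thesis using Q[OF that] unfolding f g
      by (simp only: restrict_apply' left_diff_distrib sum_subtractf right_minus_eq)
  qed
  then have "?D = {}" using uniq[of "\<lambda>S. \<theta> S - \<eta> S"] le by blast
  then have "\<theta> S = \<eta> S" if "S \<in> Pow {1..n}" for S using that by auto
  then show "f = g" unfolding f g by (intro restrict_ext sum.cong) auto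
qed (use assms in auto)

lemma query_complexity_sparse_class_upper:
  assumes s: "1 \<le> s" and n: "1 \<le> n" and "0 < \<epsilon>" "0 \<le> \<delta>"
  shows "query_complexity n (sparse_class n s) \<epsilon> \<delta>
           \<le> ereal (303104 * real s * real n * (ln (2 * real s))\<^sup>2)"
proof -
  \<comment> \<open>\<open>L\<close> gives \<open>2 * k <= exp L <= 4 ^ L\<close>. In
    \<open>T\<close>, \<open>72 = 8 * 9\<close>: since \<open>L <= 4 * k\<close>,
    \<open>25 * k * L <= 2 ^ 7 * k * k\<close>, whose logarithm is at most
    \<open>9 * l\<close>.\<close>
  define k where "k = 2 * s"
  define l where "l = ln (real k)"
  define L where "L = nat \<lceil>ln (2 * real k)\<rceil>"
  define T where "T = nat \<lceil>72 * l\<rceil>"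
  define m where "m = 256 * k * L * (n + 1) * T"
  have k: "2 \<le> k" using s by (simp add: k_def)
  \<comment> \<open>The resulting \<open>1 <= 2 * l\<close> absorbs the rounding in \<open>L\<close>
    and \<open>T\<close>.\<close>
  have ln2: "1 \<le> 2 * ln (2::real)" using ln2_ge_two_thirds by simp
  have "ln 2 \<le> l" unfolding l_def using k by simp
  then have l: "1 \<le> 2 * l" "ln 2 \<le> l" using ln2 by auto
  have ln2k: "ln (2 * real k) = ln 2 + l" using k by (simp add: l_def ln_mult)
  have L_ge: "ln (2 * real k) \<le> L" unfolding L_def by linarith
  have L_le: "L \<le> 4 * l" unfolding L_def ln2k using l by linarith
  have "0 < real L" using L_ge ln2k l ln2 by linarith
  then have L_pos: "0 < L" by simp
  have T_le: "T \<le> 74 * l" unfolding T_def using l by linarith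
  have "2 * real k = exp (ln (2 * real k))" using k by simp
  also have "\<dots> \<le> exp (real L)" using L_ge by simp
  also have "\<dots> = exp 1 ^ L" by (simp add: exp_of_nat_mult[symmetric])
  also have "\<dots> \<le> 4 ^ L" using e_less_272 by (intro power_mono) auto
  finally have "real (2 * k) \<le> real (4 ^ L)" by simp
  then have kL: "2 * k \<le> 4 ^ L" by (simp only: of_nat_le_iff)
  have T_ge: "8 * ln (25 * k * L) \<le> T"
  proof -
    have "l \<le> k" unfolding l_def using k ln_le_minus_one[of "real k"] by simp
    then have "25 * real k * L \<le> 25 * real k * (4 * k)" using L_le by (intro mult_left_mono) auto
    also have "\<dots> \<le> 2 ^ 7 * (real k * k)" by simp
    finally have "25 * real k * L \<le> 2 ^ 7 * (real k * k)" .
    then have "ln (25 * real k * L) \<le> ln (2 ^ 7 * (real k * k))"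
      using k L_pos by (subst ln_le_cancel_iff) auto
    also have "\<dots> = 7 * ln 2 + 2 * l" using k by (simp add: ln_mult ln_realpow l_def del: power_numeral)
    also have "\<dots> \<le> 9 * l" using l by simp
    finally show ?thesis unfolding T_def by simp linarith
  qed
  obtain Q where Q: "Q \<in> {..<m} \<rightarrow>\<^sub>E cube n"
    and uniq: "\<And>\<theta>. {S \<in> Pow {1..n}. \<theta> S \<noteq> 0} \<noteq> {} \<Longrightarrow> card {S \<in> Pow {1..n}. \<theta> S \<noteq> 0} \<le> k \<Longrightarrow>
      \<exists>j<m. (\<Sum>S\<in>Pow {1..n}. \<theta> S * chi S (Q j)) \<noteq> 0"
    by (rule exists_uniqueness_set[OF _ kL L_pos T_ge m_def]) (use k in auto)
  have "query_complexity n (sparse_class n s) \<epsilon> \<delta> \<le> ereal (real m)"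
  proof (rule query_complexity_sparse_class_le_of_uniqueness)
    show "Q j \<in> cube n" if "j < m" for j using PiE_mem[OF Q] that by simp
  qed (use uniq assms in \<open>simp_all only: k_def\<close>)
  also have "ereal (real m) \<le> ereal (303104 * real s * real n * (ln (2 * real s))\<^sup>2)"
  proof -
    \<comment> \<open>The constant is \<open>512 * 4 * 74 * 2\<close>, the last factor coming from
      \<open>n + 1 <= 2 * n\<close>.\<close>
    have "real m = 512 * real s * ((real L * T) * (n + 1))" by (simp add: m_def k_def algebra_simps)
    also have "\<dots> \<le> 512 * real s * ((4 * l * (74 * l)) * (2 * n))"
      using L_le T_le n l by (intro mult_left_mono mult_mono) auto
    also have "\<dots> = 303104 * real s * real n * l\<^sup>2" by (simp add: power2_eq_square)
    finally show ?thesis by (simp add: l_def k_def)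
  qed
  finally show ?thesis .
qed

section \<open>Lower bound\<close>

lemma card_transcripts_le:
  assumes fin: "finite V" and V: "\<And>f x. f \<in> F \<Longrightarrow> x \<in> cube n \<Longrightarrow> f x \<in> V"
    and q: "\<And>h. q h \<in> cube n"
  shows "finite ((\<lambda>f. transcript q f t) ` F) \<and> card ((\<lambda>f. transcript q f t) ` F) \<le> card V ^ t"
proof (induction t)
  case 0
  have "card ((\<lambda>f. [] :: history) ` F) \<le> card {[] :: history}" by (rule card_mono) auto
  then show ?case by (simp add: image_constant_conv)
next
  case (Suc t)
  let ?T = "\<lambda>t. (\<lambda>f. transcript q f t) ` F"
  let ?ext = "\<lambda>(h, v). h @ [(q h, v)]"
  \<comment> \<open>The history determines the next query, so it branches only through the answer in
    \<open>V\<close>.\<close>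
  have sub: "?T (Suc t) \<subseteq> ?ext ` (?T t \<times> V)"
    using V q by (force simp: Let_def)
  have fin': "finite (?T t \<times> V)" using Suc fin by simp
  have "card (?T (Suc t)) \<le> card (?ext ` (?T t \<times> V))"
    by (rule card_mono[OF finite_imageI[OF fin'] sub])
  also have "\<dots> \<le> card (?T t) * card V"
    using card_image_le[OF fin', of ?ext] by (simp add: card_cartesian_product)
  also have "\<dots> \<le> card V ^ Suc t" using Suc by (simp add: mult.commute)
  finally show ?case using finite_subset[OF sub] fin' by blast
qed

text \<open>Against a fixed \<open>f\<close> only finitely many histories of length \<open>t\<close>
  can occur, so measurability of the run reduces to that of the next query for each fixed
  history.\<close>

lemma measurable_transcript:
  assumes q: "\<And>h. (\<lambda>\<omega>. qry \<omega> h) \<in> M \<rightarrow>\<^sub>M count_space (cube n)"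
  shows "(\<lambda>\<omega>. transcript (qry \<omega>) f t)
    \<in> M \<rightarrow>\<^sub>M count_space {h. set h \<subseteq> (\<lambda>x. (x, f x)) ` cube n \<and> length h = t}"
proof (induction t)
  case 0
  show ?case by (simp add: measurable_const)
next
  case (Suc t)
  let ?H = "\<lambda>t. {h. set h \<subseteq> (\<lambda>x. (x, f x)) ` cube n \<and> length h = t}"
  have "(\<lambda>\<omega>. (\<lambda>h \<omega>. h @ [(qry \<omega> h, f (qry \<omega> h))]) (transcript (qry \<omega>) f t) \<omega>) \<in> M \<rightarrow>\<^sub>M count_space (?H (Suc t))"
  proof (rule measurable_compose_countable'[OF _ Suc.IH])
    show "countable (?H t)" by (intro countable_finite finite_lists_length_eq) simp
    fix h assume h: "h \<in> ?H t"
    have "(\<lambda>x. h @ [(x, f x)]) \<in> count_space (cube n) \<rightarrow>\<^sub>M count_space (?H (Suc t))"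
      using h by (auto simp: measurable_count_space_eq1)
    from measurable_compose[OF q this]
    show "(\<lambda>\<omega>. h @ [(qry \<omega> h, f (qry \<omega> h))]) \<in> M \<rightarrow>\<^sub>M count_space (?H (Suc t))" .
  qed
  then show ?case by (simp add: Let_def)
qed

lemma failure_event_sets:
  assumes "learner n M qry est"
  shows "{\<omega> \<in> space M. \<epsilon> < linf n (\<lambda>x. f x - est \<omega> (transcript (qry \<omega>) f m) x)} \<in> sets M"
proof -
  let ?H = "{h. set h \<subseteq> (\<lambda>x. (x, f x)) ` cube n \<and> length h = m}"
  have qry: "(\<lambda>\<omega>. qry \<omega> h) \<in> M \<rightarrow>\<^sub>M count_space (cube n)"
    and est: "x \<in> cube n \<Longrightarrow> (\<lambda>\<omega>. est \<omega> h x) \<in> borel_measurable M" for h x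
    using assms by (auto simp: learner_def)
  have "(\<lambda>\<omega>. (\<lambda>h \<omega>. linf n (\<lambda>x. f x - est \<omega> h x)) (transcript (qry \<omega>) f m) \<omega>) \<in> borel_measurable M"
  proof (rule measurable_compose_countable'[OF _ measurable_transcript[OF qry]])
    show "countable ?H" by (intro countable_finite finite_lists_length_eq) simp
    show "(\<lambda>\<omega>. linf n (\<lambda>x. f x - est \<omega> h x)) \<in> borel_measurable M" for h
      unfolding linf_def
      by (intro borel_measurable_Max finite_cube borel_measurable_abs borel_measurable_diff
          borel_measurable_const est)
  qed
  then show ?thesis by measurable
qed

lemma linf_le_iff: "linf n f \<le> c \<longleftrightarrow> (\<forall>x\<in>cube n. \<bar>f x\<bar> \<le> c)"
  by (simp add: linf_def)

text \<open>Averaging over the seed turns a randomised learner into a deterministic one that succeeds on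
  most members of a finite family.\<close>

lemma exists_seed_few_failures:
  fixes \<delta> :: real
  assumes lrn: "learner n M qry est" and fin: "finite I"
    and fail: "\<And>i. i \<in> I \<Longrightarrow> failure_prob n m M qry est \<epsilon> (f i) \<le> \<delta>"
  obtains \<omega> where "\<omega> \<in> space M"
    and "card {i \<in> I. \<epsilon> < linf n (\<lambda>x. f i x - est \<omega> (transcript (qry \<omega>) (f i) m) x)} \<le> \<delta> * card I"
proof -
  interpret prob_space M using lrn by (simp add: learner_def)
  define E where "E i = {\<omega> \<in> space M. \<epsilon> < linf n (\<lambda>x. f i x - est \<omega> (transcript (qry \<omega>) (f i) m) x)}" for i
  have E: "E i \<in> events" for i unfolding E_def by (rule failure_event_sets[OF lrn])
  have int: "integrable M (\<lambda>\<omega>. \<Sum>i\<in>I. indicator (E i) \<omega> :: real)"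
    by (intro Bochner_Integration.integrable_sum integrable_real_indicator E) (simp add: emeasure_eq_measure)
  have "expectation (\<lambda>\<omega>. \<Sum>i\<in>I. indicator (E i) \<omega>) = (\<Sum>i\<in>I. prob (E i))"
    using E by (subst Bochner_Integration.integral_sum)
      (auto intro!: integrable_real_indicator simp: emeasure_eq_measure)
  also have "\<dots> \<le> (\<Sum>i\<in>I. \<delta>)"
    using fail by (intro sum_mono) (simp add: failure_prob_def E_def)
  finally have le: "expectation (\<lambda>\<omega>. \<Sum>i\<in>I. indicator (E i) \<omega>) \<le> \<delta> * card I" by (simp add: mult.commute)
  have "\<exists>\<omega>\<in>space M. (\<Sum>i\<in>I. indicator (E i) \<omega>) \<le> \<delta> * card I"
  proof (rule ccontr)
    assume "\<not> ?thesis"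
    then have "AE \<omega> in M. \<delta> * card I < (\<Sum>i\<in>I. indicator (E i) \<omega>)" by (intro AE_I2) auto
    then have "\<delta> * card I < expectation (\<lambda>\<omega>. \<Sum>i\<in>I. indicator (E i) \<omega>)"
      by (intro expectation_greater int)
    with le show False by simp
  qed
  then obtain \<omega> where \<omega>: "\<omega> \<in> space M" "(\<Sum>i\<in>I. indicator (E i) \<omega>) \<le> \<delta> * card I" by blast
  have "(\<Sum>i\<in>I. indicator (E i) \<omega> :: real)
      = card {i \<in> I. \<epsilon> < linf n (\<lambda>x. f i x - est \<omega> (transcript (qry \<omega>) (f i) m) x)}"
    using fin \<omega>(1) by (simp add: indicator_def E_def Int_def)
  with \<omega> show thesis by (intro that) auto
qed

section \<open>The hard family: averages of tagged parities\<close>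

definition parity_index :: "nat \<Rightarrow> nat \<Rightarrow> (nat \<Rightarrow> nat set) set" where
  "parity_index n r = {1..r} \<rightarrow>\<^sub>E Pow {r + 1..n}"

text \<open>Coordinate \<open>i\<close> tags the \<open>i\<close>-th term. The sets
  \<open>A i\<close> avoid all tags, so the characters are distinct and each sign can be flipped
  independently of the others.\<close>

definition parity_sum :: "nat \<Rightarrow> nat \<Rightarrow> (nat \<Rightarrow> nat set) \<Rightarrow> point \<Rightarrow> real" where
  "parity_sum n r A = (\<lambda>x\<in>cube n. (\<Sum>i\<in>{1..r}. chi (insert i (A i)) x) / r)"

lemma parity_index_subset:
  assumes "A \<in> parity_index n r" "i \<in> {1..r}"
  shows "A i \<subseteq> {r + 1..n}"
  using PiE_mem[OF assms[unfolded parity_index_def]] by simp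

lemma chi_insert_parity:
  assumes "A \<in> parity_index n r" "i \<in> {1..r}"
  shows "chi (insert i (A i)) x = x i * chi (A i) x"
proof -
  have "finite (A i)" "i \<notin> A i"
    using parity_index_subset[OF assms] assms(2) finite_subset by fastforce+
  then show ?thesis by (simp add: chi_def)
qed

lemma parity_support:
  assumes "A \<in> parity_index n r" "i \<in> {1..r}" "r \<le> n"
  shows "insert i (A i) \<subseteq> {1..n}"
  using parity_index_subset[OF assms(1,2)] assms(2,3) by fastforce

lemma finite_parity_index: "finite (parity_index n r)"
  unfolding parity_index_def by (intro finite_PiE) auto

lemma card_parity_index: "card (parity_index n r) = (2 ^ (n - r)) ^ r"
  by (simp add: parity_index_def card_PiE card_Pow)

text \<open>A sum of \<open>r\<close> signs depends only on how many equal 1, which leaves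
  \<open>r + 1\<close> possible answers to a query.\<close>

lemma parity_sum_value:
  assumes A: "A \<in> parity_index n r" and x: "x \<in> cube n" and r: "0 < r" "r \<le> n"
  shows "parity_sum n r A x \<in> (\<lambda>j. (2 * real j - r) / r) ` {..r}"
proof -
  let ?P = "{i \<in> {1..r}. chi (insert i (A i)) x = 1}"
  have "(\<Sum>i\<in>{1..r}. chi (insert i (A i)) x) = (\<Sum>i\<in>{1..r}. 2 * of_bool (chi (insert i (A i)) x = 1) - (1::real))"
    using chi_cases[OF x parity_support[OF A _ r(2)]] by (intro sum.cong) auto
  also have "\<dots> = 2 * (\<Sum>i\<in>{1..r}. of_bool (chi (insert i (A i)) x = 1)) - real r"
    by (simp only: sum_subtractf sum_distrib_left) simp
  also have "\<dots> = 2 * real (card ?P) - real r" by (simp add: Int_def)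
  finally have "parity_sum n r A x = (2 * real (card ?P) - r) / r"
    using x by (simp add: parity_sum_def)
  moreover have "card ?P \<le> card {1..r}" by (rule card_mono) auto
  ultimately show ?thesis by (intro image_eqI[of _ _ "card ?P"]) auto
qed

lemma parity_sum_in_sparse_class:
  assumes A: "A \<in> parity_index n r" and r: "0 < r" "r \<le> n" "r \<le> s"
  shows "parity_sum n r A \<in> sparse_class n s"
proof -
  let ?g = "\<lambda>i. insert i (A i)"
  have inj: "inj_on ?g {1..r}"
  proof (rule inj_onI)
    fix i j assume ij: "i \<in> {1..r}" "j \<in> {1..r}" "?g i = ?g j"
    then have "i \<notin> A j" using parity_index_subset[OF A ij(2)] by fastforce
    then show "i = j" using ij(3) by blast
  qed
  have sub: "?g ` {1..r} \<subseteq> Pow {1..n}" using parity_support[OF A _ r(2)] by blast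
  define \<theta> :: "nat set \<Rightarrow> real" where "\<theta> S = (if S \<in> ?g ` {1..r} then 1 / r else 0)" for S
  have eq: "(\<Sum>S\<in>Pow {1..n}. \<theta> S * chi S x) = (\<Sum>i\<in>{1..r}. chi (?g i) x) / r" for x
  proof -
    have "(\<Sum>S\<in>Pow {1..n}. \<theta> S * chi S x) = (\<Sum>S\<in>?g ` {1..r}. 1 / r * chi S x)"
      using sub by (intro sum.mono_neutral_cong_right) (auto simp: \<theta>_def)
    also have "\<dots> = (\<Sum>i\<in>{1..r}. 1 / r * chi (?g i) x)"
      by (simp only: sum.reindex[OF inj] comp_def)
    finally show ?thesis by (simp add: sum_divide_distrib)
  qed
  have "{S \<in> Pow {1..n}. \<theta> S \<noteq> 0} \<subseteq> ?g ` {1..r}" by (auto simp: \<theta>_def split: if_splits)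
  then have "card {S \<in> Pow {1..n}. \<theta> S \<noteq> 0} \<le> card (?g ` {1..r})" by (intro card_mono) auto
  also have "\<dots> \<le> card {1..r}" by (rule card_image_le) simp
  finally have card: "card {S \<in> Pow {1..n}. \<theta> S \<noteq> 0} \<le> s" using r by simp
  have "linf n (parity_sum n r A) \<le> 1"
    unfolding linf_le_iff
  proof
    fix x assume x: "x \<in> cube n"
    have "\<bar>\<Sum>i\<in>{1..r}. chi (?g i) x\<bar> \<le> (\<Sum>i\<in>{1..r}. \<bar>chi (?g i) x\<bar>)" by (rule sum_abs)
    also have "\<dots> = r" using abs_chi[OF x parity_support[OF A _ r(2)]] by simp
    finally show "\<bar>parity_sum n r A x\<bar> \<le> 1" using x r by (simp add: parity_sum_def)
  qed
  with card eq show ?thesis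
    unfolding sparse_class_def parity_sum_def by (intro CollectI exI[of _ \<theta>]) simp
qed

text \<open>On average over \<open>z\<close>, half of the parities with \<open>A i \<noteq> B i\<close> disagree at \<open>z\<close>; since the parities
  do not involve the coordinates in \<open>{1..r}\<close>, these can be reset to align all terms of \<open>A\<close>.\<close>

lemma parity_sum_separation:
  assumes A: "A \<in> parity_index n r" and B: "B \<in> parity_index n r" and r: "0 < r" "r \<le> n"
  obtains z where "z \<in> cube n"
    and "card {i \<in> {1..r}. A i \<noteq> B i} \<le> r * (parity_sum n r A z - parity_sum n r B z)"
proof -
  have sub: "A i \<subseteq> {1..n}" "B i \<subseteq> {1..n}" if "i \<in> {1..r}" for i
    using parity_support[OF A that r(2)] parity_support[OF B that r(2)] by auto
  let ?S = "\<lambda>z. \<Sum>i\<in>{1..r}. 1 - chi (A i) z * chi (B i) z"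
  let ?d = "real (card {i \<in> {1..r}. A i \<noteq> B i})"
  \<comment> \<open>By orthogonality each summand has mean 1 over the cube if \<open>A i\<close> and
    \<open>B i\<close> differ, and mean 0 otherwise; some \<open>z\<close> reaches the mean of the
    sum.\<close>
  have "(\<Sum>z\<in>cube n. ?S z) = (\<Sum>i\<in>{1..r}. \<Sum>z\<in>cube n. 1 - chi (A i) z * chi (B i) z)"
    by (rule sum.swap)
  also have "\<dots> = (\<Sum>i\<in>{1..r}. 2 ^ n * of_bool (A i \<noteq> B i))"
  proof (intro sum.cong refl)
    fix i assume i: "i \<in> {1..r}"
    show "(\<Sum>z\<in>cube n. 1 - chi (A i) z * chi (B i) z) = 2 ^ n * of_bool (A i \<noteq> B i)"
      by (simp add: sum_subtractf sum_chi_mult_chi[OF sub[OF i]] card_cube)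
  qed
  also have "\<dots> = 2 ^ n * ?d" by (simp add: sum_distrib_left[symmetric] Int_def)
  finally have total: "(\<Sum>z\<in>cube n. ?S z) = (\<Sum>z\<in>cube n. ?d)" by (simp add: card_cube)
  have "\<exists>z\<in>cube n. ?d \<le> ?S z"
  proof (rule ccontr)
    assume "\<not> ?thesis"
    then have "(\<Sum>z\<in>cube n. ?S z) < (\<Sum>z\<in>cube n. ?d)"
      by (intro sum_strict_mono) (auto simp: not_le)
    with total show False by simp
  qed
  then obtain z where z: "z \<in> cube n" "?d \<le> ?S z" by blast
  \<comment> \<open>Setting tag \<open>i\<close> to \<open>chi (A i) z\<close> makes the
    \<open>i\<close>-th term of \<open>A\<close> equal to 1 and that of \<open>B\<close> equal to
    the product of the two parities at \<open>z\<close>.\<close>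
  define w where "w j = (if j \<in> {1..r} then chi (A j) z else z j)" for j
  have w: "w \<in> cube n"
    unfolding cube_def
  proof (rule PiE_I)
    show "w j \<in> {-1, 1}" if "j \<in> {1..n}" for j
      using chi_cases[OF z(1) sub(1)] PiE_mem[OF z(1)[unfolded cube_def] that] by (auto simp: w_def)
    show "w j = undefined" if "j \<notin> {1..n}" for j
      using PiE_arb[OF z(1)[unfolded cube_def] that] that r(2) by (auto simp: w_def)
  qed
  have chi_w: "chi S w = chi S z" if "S \<subseteq> {r + 1..n}" for S
    unfolding chi_def using that by (intro prod.cong) (auto simp: w_def)
  have term_diff: "chi (insert i (A i)) w - chi (insert i (B i)) w = 1 - chi (A i) z * chi (B i) z"
    if i: "i \<in> {1..r}" for i
  proof -
    have "chi (A i) z * chi (A i) z = 1" using chi_cases[OF z(1) sub(1)[OF i]] by auto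
    then show ?thesis using i
      by (simp add: chi_insert_parity[OF A i] chi_insert_parity[OF B i]
          chi_w[OF parity_index_subset[OF A i]] chi_w[OF parity_index_subset[OF B i]] w_def
          right_diff_distrib)
  qed
  have "r * (parity_sum n r A w - parity_sum n r B w)
      = (\<Sum>i\<in>{1..r}. chi (insert i (A i)) w - chi (insert i (B i)) w)"
    using w r by (simp add: parity_sum_def sum_subtractf right_diff_distrib)
  also have "\<dots> = ?S z" using term_diff by (rule sum.cong[OF refl])
  finally show thesis using z w by (intro that[of w]) simp_all
qed

text \<open>There are at most \<open>2 ^ r\<close> choices for the set of differing indices, and the
  entries on it are then free.\<close>

lemma card_parity_ball_le:
  assumes B: "B \<in> parity_index n r"
  shows "card {A \<in> parity_index n r. card {i \<in> {1..r}. A i \<noteq> B i} \<le> d} \<le> 2 ^ r * (2 ^ (n - r)) ^ d"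
proof -
  let ?N = "2 ^ (n - r) :: nat"
  define R where "R D = PiE {1..r} (\<lambda>i. if i \<in> D then Pow {r + 1..n} else {B i})" for D
  define X where "X = {D \<in> Pow {1..r}. card D \<le> d}"
  have X: "finite X" "card X \<le> 2 ^ r"
  proof -
    show "finite X" by (simp add: X_def)
    have "card X \<le> card (Pow {1..r})" unfolding X_def by (rule card_mono) auto
    then show "card X \<le> 2 ^ r" by (simp add: card_Pow)
  qed
  have "{A \<in> parity_index n r. card {i \<in> {1..r}. A i \<noteq> B i} \<le> d} \<subseteq> (\<Union>D\<in>X. R D)"
  proof
    fix A assume A: "A \<in> {A \<in> parity_index n r. card {i \<in> {1..r}. A i \<noteq> B i} \<le> d}"
    then have "{i \<in> {1..r}. A i \<noteq> B i} \<in> X" by (auto simp: X_def)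
    moreover have "A \<in> R {i \<in> {1..r}. A i \<noteq> B i}"
      using A by (auto simp: R_def parity_index_def PiE_iff)
    ultimately show "A \<in> (\<Union>D\<in>X. R D)" by blast
  qed
  moreover have "finite (\<Union>D\<in>X. R D)"
    using X by (auto simp: R_def intro!: finite_PiE)
  ultimately have "card {A \<in> parity_index n r. card {i \<in> {1..r}. A i \<noteq> B i} \<le> d} \<le> card (\<Union>D\<in>X. R D)"
    by (intro card_mono)
  also have "\<dots> \<le> (\<Sum>D\<in>X. card (R D))" by (rule card_UN_le[OF X(1)])
  also have "\<dots> \<le> (\<Sum>D\<in>X. ?N ^ d)"
  proof (rule sum_mono)
    fix D assume D: "D \<in> X"
    have "card (R D) = (\<Prod>i\<in>{1..r}. if i \<in> D then ?N else 1)"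
      by (auto simp: R_def card_PiE card_Pow intro!: prod.cong)
    also have "\<dots> = ?N ^ card D"
      using D by (simp add: X_def prod.If_cases Int_absorb1)
    also have "\<dots> \<le> ?N ^ d" using D by (intro power_increasing) (auto simp: X_def)
    finally show "card (R D) \<le> ?N ^ d" .
  qed
  also have "\<dots> \<le> 2 ^ r * ?N ^ d" using X(2) by simp
  finally show ?thesis .
qed

section \<open>Counting transcripts and the resulting query bound\<close>

lemma queries_pos:
  assumes lrn: "learner n M qry est" and s: "1 \<le> s" and \<epsilon>: "\<epsilon> < 1" and \<delta>: "\<delta> \<le> 1/4"
    and fail: "\<And>f. f \<in> sparse_class n s \<Longrightarrow> failure_prob n m M qry est \<epsilon> f \<le> \<delta>"
  shows "0 < m"
proof (rule ccontr)
  assume "\<not> 0 < m"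
  then have m: "m = 0" by simp
  \<comment> \<open>Without queries the constants 1 and -1 receive the same estimate, although they
    are at distance 2.\<close>
  define f where "f c = (\<lambda>x\<in>cube n. c)" for c :: real
  have f: "f c \<in> sparse_class n s" if "c \<in> {1, -1}" for c
  proof -
    define \<theta> :: "nat set \<Rightarrow> real" where "\<theta> S = (if S = {} then c else 0)" for S
    have "(\<Sum>S\<in>Pow {1..n}. \<theta> S * chi S x) = c" for x
    proof -
      have "(\<Sum>S\<in>Pow {1..n}. \<theta> S * chi S x) = (\<Sum>S\<in>{{} :: nat set}. c)"
        by (rule sum.mono_neutral_cong_right) (auto simp: \<theta>_def chi_def)
      then show ?thesis by simp
    qed
    moreover have "card {S \<in> Pow {1..n}. \<theta> S \<noteq> 0} \<le> card {{} :: nat set}"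
      by (rule card_mono) (auto simp: \<theta>_def)
    moreover have "linf n (f c) \<le> 1" using that by (auto simp: linf_le_iff f_def)
    ultimately show ?thesis
      using s unfolding sparse_class_def f_def by (intro CollectI exI[of _ \<theta>]) simp
  qed
  obtain \<omega> where \<omega>: "card {c \<in> {1, -1}. \<epsilon> < linf n (\<lambda>x. f c x - est \<omega> (transcript (qry \<omega>) (f c) m) x)}
      \<le> \<delta> * card {1, -1 :: real}"
  proof (rule exists_seed_few_failures[OF lrn, where I = "{1, -1}" and f = f])
    show "failure_prob n m M qry est \<epsilon> (f c) \<le> \<delta>" if "c \<in> {1, -1}" for c
      by (rule fail[OF f[OF that]])
  qed simp
  let ?Bad = "{c \<in> {1, -1}. \<epsilon> < linf n (\<lambda>x. f c x - est \<omega> (transcript (qry \<omega>) (f c) m) x)}"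
  \<comment> \<open>At most half a failure on average means that the chosen seed fails on neither
    constant.\<close>
  have "\<delta> * card {1, -1 :: real} < 1" using \<delta> by simp
  with \<omega> have "real (card ?Bad) < 1" by (rule le_less_trans)
  then have "card ?Bad = 0" by linarith
  then have "?Bad = {}" by (subst (asm) card_0_eq) auto
  then have close: "linf n (\<lambda>x. f c x - est \<omega> [] x) \<le> \<epsilon>" if "c \<in> {1, -1}" for c
    using that m by (auto simp: not_less)
  obtain x where x: "x \<in> cube n" using cube_nonempty by blast
  have "\<bar>1 - est \<omega> [] x\<bar> \<le> \<epsilon>" "\<bar>-1 - est \<omega> [] x\<bar> \<le> \<epsilon>"
    using close[of 1] close[of "-1"] x by (auto simp: linf_le_iff f_def)
  then show False using \<epsilon> by linarith
qed

text \<open>For a well-chosen seed, the tuples estimated correctly are sorted by transcript into at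
  most \<open>(r + 1) ^ m\<close> cells. Each cell fits into a Hamming ball of radius
  \<open>r div 4\<close>.\<close>

lemma parity_counting_bound:
  fixes r :: nat
  assumes lrn: "learner n M qry est" and r: "0 < r" "r \<le> n" "r \<le> s"
    and \<epsilon>: "\<epsilon> \<le> 1/8" and \<delta>: "\<delta> \<le> 1/4"
    and fail: "\<And>f. f \<in> sparse_class n s \<Longrightarrow> failure_prob n m M qry est \<epsilon> f \<le> \<delta>"
  shows "(2 ^ (n - r)) ^ r \<le> 2 * ((r + 1) ^ m * (2 ^ r * (2 ^ (n - r)) ^ (r div 4)))"
proof -
  let ?I = "parity_index n r"
  let ?ball = "2 ^ r * (2 ^ (n - r)) ^ (r div 4) :: nat"
  obtain \<omega> where \<omega>: "\<omega> \<in> space M"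
    and few: "card {A \<in> ?I. \<epsilon> < linf n (\<lambda>x. parity_sum n r A x
        - est \<omega> (transcript (qry \<omega>) (parity_sum n r A) m) x)} \<le> \<delta> * card ?I"
  proof (rule exists_seed_few_failures[OF lrn finite_parity_index, where f = "parity_sum n r"])
    show "failure_prob n m M qry est \<epsilon> (parity_sum n r A) \<le> \<delta>" if "A \<in> ?I" for A
      by (rule fail[OF parity_sum_in_sparse_class[OF that r]])
  qed
  define tr where "tr A = transcript (qry \<omega>) (parity_sum n r A) m" for A
  define Bad where "Bad = {A \<in> ?I. \<epsilon> < linf n (\<lambda>x. parity_sum n r A x - est \<omega> (tr A) x)}"
  have q: "qry \<omega> h \<in> cube n" for h
  proof -
    have "(\<lambda>\<omega>. qry \<omega> h) \<in> M \<rightarrow>\<^sub>M count_space (cube n)" using lrn by (simp add: learner_def)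
    from measurable_space[OF this \<omega>] show ?thesis by simp
  qed
  let ?V = "(\<lambda>j. (2 * real j - r) / r) ` {..r}"
  have "finite (tr ` ?I)" and "card (tr ` ?I) \<le> card ?V ^ m"
  proof -
    have img: "tr ` ?I = (\<lambda>f. transcript (qry \<omega>) f m) ` (parity_sum n r ` ?I)"
      by (simp add: image_image tr_def)
    have "finite (tr ` ?I) \<and> card (tr ` ?I) \<le> card ?V ^ m"
      unfolding img
    proof (rule card_transcripts_le)
      show "f x \<in> ?V" if "f \<in> parity_sum n r ` ?I" "x \<in> cube n" for f x
        using that parity_sum_value[OF _ _ r(1,2)] by blast
    qed (simp_all add: q)
    then show "finite (tr ` ?I)" "card (tr ` ?I) \<le> card ?V ^ m" by simp_all
  qed
  have "card ?V \<le> card {..r}" by (rule card_image_le) simp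
  then have "card ?V ^ m \<le> (r + 1) ^ m" by (intro power_mono) auto
  with \<open>card (tr ` ?I) \<le> card ?V ^ m\<close> have card_tr: "card (tr ` ?I) \<le> (r + 1) ^ m" by linarith
  \<comment> \<open>Any member \<open>B\<close> of the cell serves as centre: two members share an
    estimate, so their functions differ by at most \<open>2 * \<epsilon> <= 1/4\<close>, and
    separation bounds the fraction of differing indices.\<close>
  have cell: "card {A \<in> ?I - Bad. tr A = h} \<le> ?ball" for h
  proof (cases "{A \<in> ?I - Bad. tr A = h} = {}")
    case False
    then obtain B where B: "B \<in> ?I - Bad" "tr B = h" by blast
    have "{A \<in> ?I - Bad. tr A = h} \<subseteq> {A \<in> ?I. card {i \<in> {1..r}. A i \<noteq> B i} \<le> r div 4}"
    proof
      fix A assume "A \<in> {A \<in> ?I - Bad. tr A = h}"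
      then have A: "A \<in> ?I" "A \<notin> Bad" "tr A = h" by auto
      obtain z where z: "z \<in> cube n"
        and dist: "card {i \<in> {1..r}. A i \<noteq> B i} \<le> r * (parity_sum n r A z - parity_sum n r B z)"
        using parity_sum_separation[of A n r B] A B r by auto
      have "\<bar>parity_sum n r A z - est \<omega> h z\<bar> \<le> \<epsilon>" "\<bar>parity_sum n r B z - est \<omega> h z\<bar> \<le> \<epsilon>"
        using A B z by (auto simp: Bad_def not_less linf_le_iff)
      then have "parity_sum n r A z - parity_sum n r B z \<le> 1 / 4" using \<epsilon> by linarith
      then have "r * (parity_sum n r A z - parity_sum n r B z) \<le> r * (1 / 4)" by (intro mult_left_mono) auto
      with dist have "real (card {i \<in> {1..r}. A i \<noteq> B i}) \<le> r / 4" by simp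
      then have "card {i \<in> {1..r}. A i \<noteq> B i} * 4 \<le> r" by linarith
      then have "card {i \<in> {1..r}. A i \<noteq> B i} \<le> r div 4" by linarith
      with A show "A \<in> {A \<in> ?I. card {i \<in> {1..r}. A i \<noteq> B i} \<le> r div 4}" by blast
    qed
    then have "card {A \<in> ?I - Bad. tr A = h} \<le> card {A \<in> ?I. card {i \<in> {1..r}. A i \<noteq> B i} \<le> r div 4}"
      using finite_parity_index by (intro card_mono) auto
    also have "\<dots> \<le> ?ball" using B by (intro card_parity_ball_le) simp
    finally show ?thesis .
  qed (metis card.empty zero_le)
  have "card (?I - Bad) \<le> card (\<Union>h\<in>tr ` ?I. {A \<in> ?I - Bad. tr A = h})"
    using finite_parity_index \<open>finite (tr ` ?I)\<close> by (intro card_mono) auto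
  also have "\<dots> \<le> (\<Sum>h\<in>tr ` ?I. card {A \<in> ?I - Bad. tr A = h})"
    by (rule card_UN_le) fact
  also have "\<dots> \<le> (\<Sum>h\<in>tr ` ?I. ?ball)" by (rule sum_mono) (rule cell)
  also have "\<dots> \<le> (r + 1) ^ m * ?ball" unfolding sum_constant of_nat_id by (intro mult_right_mono card_tr) simp
  finally have good: "card (?I - Bad) \<le> (r + 1) ^ m * ?ball" .
  \<comment> \<open>At most a quarter of the tuples fail, so the good ones are at least half; this
    is the leading factor 2.\<close>
  have "\<delta> * card ?I \<le> 1 / 4 * card ?I" using \<delta> by (intro mult_right_mono) auto
  then have "real (card Bad) \<le> 1 / 4 * card ?I" using few by (simp add: Bad_def tr_def)
  then have "2 * card Bad \<le> card ?I" by linarith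
  moreover have "card ?I = card Bad + card (?I - Bad)"
  proof -
    have "Bad \<subseteq> ?I" by (auto simp: Bad_def)
    then show ?thesis using finite_parity_index
      by (metis card_Diff_subset card_mono finite_subset le_add_diff_inverse)
  qed
  ultimately have "card ?I \<le> 2 * card (?I - Bad)" by linarith
  also have "\<dots> \<le> 2 * ((r + 1) ^ m * ?ball)" using good by (rule mult_le_mono2)
  finally show ?thesis by (simp only: card_parity_index)
qed

lemma queries_lower_bound:
  assumes lrn: "learner n M qry est" and s: "1 \<le> s" "s \<le> n" and \<epsilon>: "\<epsilon> \<le> 1/8" and \<delta>: "\<delta> \<le> 1/4"
    and fail: "\<And>f. f \<in> sparse_class n s \<Longrightarrow> failure_prob n m M qry est \<epsilon> f \<le> \<delta>"
  shows "1/200 * (real s * real n / ln (2 * real s)) \<le> real m"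
proof -
  have ln2: "2/3 \<le> ln (2::real)" by (rule ln2_ge_two_thirds)
  have ln2s: "ln 2 \<le> ln (2 * real s)" using s by simp
  show ?thesis
  proof (cases "n < 8")
    \<comment> \<open>For small \<open>n\<close> the claimed bound is at most 1, and one query is
      always required.\<close>
    case True
    have "real s * real n \<le> 7 * 7" using True s by (intro mult_mono) auto
    also have "\<dots> \<le> 200 * ln (2 * real s)" using ln2 ln2s by simp
    finally have "1/200 * (real s * real n / ln (2 * real s)) \<le> 1"
      using ln2 ln2s by (simp add: divide_le_eq)
    moreover have "0 < m" by (rule queries_pos[OF lrn s(1) _ \<delta> fail]) (use \<epsilon> in auto)
    ultimately show ?thesis by linarith
  next
    case False
    \<comment> \<open>Half of \<open>s\<close>, rounded up: \<open>r\<close> stays comparable to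
      \<open>s\<close> while at least a quarter of the coordinates remain for the sets
      \<open>A i\<close>, even when \<open>s = n\<close>.\<close>
    define r where "r = (s + 1) div 2"
    define N where "N = n - r"
    have r: "0 < r" "r \<le> n" "r \<le> s" "s \<le> 2 * r" "r + 1 \<le> 2 * s" using s by (auto simp: r_def)
    have N: "4 \<le> N" "n \<le> 4 * N" using s False by (auto simp: N_def r_def)
    have "(2 ^ N) ^ r \<le> 2 * ((r + 1) ^ m * (2 ^ r * (2 ^ N) ^ (r div 4)))"
      unfolding N_def by (rule parity_counting_bound[OF lrn r(1-3) \<epsilon> \<delta> fail])
    then have "real ((2 ^ N) ^ r) \<le> real (2 * ((r + 1) ^ m * (2 ^ r * (2 ^ N) ^ (r div 4))))"
      by (simp only: of_nat_le_iff)
    then have "ln (real ((2 ^ N) ^ r)) \<le> ln (real (2 * ((r + 1) ^ m * (2 ^ r * (2 ^ N) ^ (r div 4)))))"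
      by (subst ln_le_cancel_iff) auto
    then have "real r * real N * ln 2
        \<le> ln 2 + (real m * ln (real r + 1) + (real r * ln 2 + real (r div 4) * real N * ln 2))"
      by (simp add: ln_mult ln_realpow ac_simps)
    moreover have "real (r div 4) * real N * ln 2 \<le> real r / 4 * real N * ln 2"
      by (intro mult_right_mono) (linarith | simp)+
    moreover have "real m * ln (real r + 1) \<le> real m * ln (2 * real s)"
      using r by (intro mult_left_mono) auto
    ultimately have "(3/4 * (real r * real N) - real r - 1) * ln 2 \<le> real m * ln (2 * real s)"
      by (simp add: algebra_simps)
    \<comment> \<open>Since \<open>4 <= N\<close> and \<open>1 <= r\<close>, the loss
      \<open>r + 1\<close> is at most \<open>r * N / 2\<close>.\<close>
    moreover have "real r * real N / 4 * (2/3) \<le> (3/4 * (real r * real N) - real r - 1) * ln 2"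
    proof (rule mult_mono)
      have "real r * 4 \<le> real r * real N" using N by (intro mult_left_mono) auto
      moreover have "1 \<le> real r" using r by simp
      ultimately show "real r * real N / 4 \<le> 3/4 * (real r * real N) - real r - 1" by linarith
      then show "0 \<le> 3/4 * (real r * real N) - real r - 1" by (rule order_trans[rotated]) simp
    qed (use ln2 in auto)
    moreover have "real s * real n \<le> (2 * real r) * (4 * real N)"
      using r N by (intro mult_mono) auto
    moreover have "0 \<le> real m * ln (2 * real s)" using ln2 ln2s by simp
    ultimately have "1/200 * (real s * real n) \<le> real m * ln (2 * real s)"
      by linarith
    then show ?thesis using ln2 ln2s by (simp add: divide_le_eq)
  qed
qed

lemma query_complexity_sparse_class_lower:
  assumes "1 \<le> s" "s \<le> n" "\<epsilon> \<le> 1/8" "\<delta> \<le> 1/4"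
  shows "ereal (1/200 * (real s * real n / ln (2 * real s))) \<le> query_complexity n (sparse_class n s) \<epsilon> \<delta>"
  unfolding query_complexity_def
proof (rule INF_greatest)
  fix m assume "m \<in> {m. \<exists>M qry est. learner n M qry est \<and>
    (\<forall>f\<in>sparse_class n s. failure_prob n m M qry est \<epsilon> f \<le> \<delta>)}"
  then obtain M qry est where "learner n M qry est"
    and "\<And>f. f \<in> sparse_class n s \<Longrightarrow> failure_prob n m M qry est \<epsilon> f \<le> \<delta>" by blast
  from queries_lower_bound[OF this(1) assms this(2)]
  show "ereal (1/200 * (real s * real n / ln (2 * real s))) \<le> ereal (real m)" by simp
qed

theorem propositionB2:
  "\<exists>C c \<epsilon>\<^sub>0 \<delta>\<^sub>0 :: real. C > 0 \<and> c > 0 \<and> \<epsilon>\<^sub>0 > 0 \<and> \<delta>\<^sub>0 > 0 \<and> \<epsilon>\<^sub>0 < 1 \<and>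
     (\<forall>(n::nat) (s::nat) (\<epsilon>::real) (\<delta>::real).
        1 \<le> s \<and> s \<le> n \<and> 0 < \<epsilon> \<and> \<epsilon> \<le> \<epsilon>\<^sub>0 \<and> 0 < \<delta> \<and> \<delta> \<le> \<delta>\<^sub>0 \<longrightarrow>
        ereal (c * (real s * real n / ln (2 * real s)))
          \<le> query_complexity n (sparse_class n s) \<epsilon> \<delta> \<and>
        query_complexity n (sparse_class n s) \<epsilon> \<delta>
          \<le> ereal (C * real s * real n * (ln (2 * real s))\<^sup>2)) \<and>
     soft_Theta_on
       {(n::nat, s::nat, \<epsilon>::real, \<delta>::real).
          1 \<le> s \<and> s \<le> n \<and> 0 < \<epsilon> \<and> \<epsilon> \<le> \<epsilon>\<^sub>0 \<and> 0 < \<delta> \<and> \<delta> \<le> \<delta>\<^sub>0}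
       (\<lambda>(n, s, \<epsilon>, \<delta>). ln (2 * real s))
       (\<lambda>(n, s, \<epsilon>, \<delta>). query_complexity n (sparse_class n s) \<epsilon> \<delta>)
       (\<lambda>(n, s, \<epsilon>, \<delta>). real s * real n)"
proof -
  \<comment> \<open>The ranges \<open>1/8\<close> and \<open>1/4\<close> for
    \<open>\<epsilon>\<close> and \<open>\<delta>\<close> come from the lower bound.\<close>
  have bounds: "ereal (1/200 * (real s * real n / ln (2 * real s)))
        \<le> query_complexity n (sparse_class n s) \<epsilon> \<delta> \<and>
      query_complexity n (sparse_class n s) \<epsilon> \<delta>
        \<le> ereal (303104 * real s * real n * (ln (2 * real s))\<^sup>2)"
    if "1 \<le> s \<and> s \<le> n \<and> 0 < \<epsilon> \<and> \<epsilon> \<le> 1/8 \<and> 0 < \<delta> \<and> \<delta> \<le> 1/4" for n s :: nat and \<epsilon> \<delta> :: real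
    using query_complexity_sparse_class_lower[of s n \<epsilon> \<delta>]
      query_complexity_sparse_class_upper[of s n \<epsilon> \<delta>] that by simp
  have soft: "soft_Theta_on
       {(n::nat, s::nat, \<epsilon>::real, \<delta>::real).
          1 \<le> s \<and> s \<le> n \<and> 0 < \<epsilon> \<and> \<epsilon> \<le> 1/8 \<and> 0 < \<delta> \<and> \<delta> \<le> 1/4}
       (\<lambda>(n, s, \<epsilon>, \<delta>). ln (2 * real s))
       (\<lambda>(n, s, \<epsilon>, \<delta>). query_complexity n (sparse_class n s) \<epsilon> \<delta>)
       (\<lambda>(n, s, \<epsilon>, \<delta>). real s * real n)"
    unfolding soft_Theta_on_def
  proof (rule exI[of _ "1/200"], rule conjI, simp, rule exI[of _ 303104], rule conjI, simp,
      rule exI[of _ 1], rule exI[of _ 2], intro ballI conjI)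
    fix p :: "nat \<times> nat \<times> real \<times> real"
    assume p: "p \<in> {(n, s, \<epsilon>, \<delta>). 1 \<le> s \<and> s \<le> n \<and> 0 < \<epsilon> \<and> \<epsilon> \<le> 1/8 \<and> 0 < \<delta> \<and> \<delta> \<le> 1/4}"
    obtain n s \<epsilon> \<delta> where eq: "p = (n, s, \<epsilon>, \<delta>)" by (cases p)
    with p have "1 \<le> s \<and> s \<le> n \<and> 0 < \<epsilon> \<and> \<epsilon> \<le> 1/8 \<and> 0 < \<delta> \<and> \<delta> \<le> 1/4" by simp
    note b = bounds[OF this]
    show "ereal (1/200 * (case p of (n, s, \<epsilon>, \<delta>) \<Rightarrow> real s * real n) /
            (case p of (n, s, \<epsilon>, \<delta>) \<Rightarrow> ln (2 * real s)) ^ 1)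
          \<le> (case p of (n, s, \<epsilon>, \<delta>) \<Rightarrow> query_complexity n (sparse_class n s) \<epsilon> \<delta>)"
      using conjunct1[OF b] by (simp add: eq)
    show "(case p of (n, s, \<epsilon>, \<delta>) \<Rightarrow> query_complexity n (sparse_class n s) \<epsilon> \<delta>)
          \<le> ereal (303104 * (case p of (n, s, \<epsilon>, \<delta>) \<Rightarrow> real s * real n) *
            (case p of (n, s, \<epsilon>, \<delta>) \<Rightarrow> ln (2 * real s)) ^ 2)"
      using conjunct2[OF b] by (simp add: eq mult.assoc)
  qed
  show ?thesis
    by (rule exI[of _ 303104], rule exI[of _ "1/200"], rule exI[of _ "1/8"], rule exI[of _ "1/4"])
      (use bounds soft in simp)
qed

end
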